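(* Let $\Omega$, the fiber $\Omega_f\subset\Omega$ of radius $a$ with center line $\Gamma$, the averaging operator $\mathcal{R}$, the function $g$, the spaces $V,W_\Gamma,Q_\Gamma$ and the finite element spaces $V_h\subset V$, $W_h\subset W_\Gamma$, $Q_h=W_h$, $\mathbb{V}_h=V_h\times W_h$ be as in the context. Assume that $\mathbb{C}_\Omega$ and $\mathbb{C}_f$ are strongly elliptic with constants $c_\Omega$ and $c_f$ respectively, such that $c_f>c_\Omega>0$, and let $\delta\mathbb{C}_f=\mathbb{C}_f-\mathbb{C}_\Omega$ and $c_\Gamma=\pi a^2$. Let $$\ker\mathbb{E}_{T,h}=\{(v_h,w_h)\in\mathbb{V}_h:\ \langle q_h,\mathcal{R}v_h-w_h\rangle=0\ \ \forall q_h\in Q_h\}.$$ Then there exists a constant $\alpha_8>0$, independent of $h$, such that $$\inf_{0\ne(u_h,w_h)\in\ker\mathbb{E}_{T,h}}\ \sup_{0\ne(v_h,y_h)\in\ker\mathbb{E}_{T,h}}\frac{(\mathbb{C}_\Omega\nabla v_h,\nabla u_h)_\Omega+c_\Gamma(g\,\delta\mathbb{C}_f\nabla_\Gamma y_h,\nabla_\Gamma w_h)_\Gamma}{\|(v_h,y_h)\|_{\mathbb{V}}\,\|(u_h,w_h)\|_{\mathbb{V}}}\ \ge\ \alpha_8 .$$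
   Context: $\Omega\subset\mathbb{R}^3$ is a connected, bounded, Lipschitz domain; $\Gamma$ is a one-dimensional curve with curvature $\kappa$ and torsion defined a.e.; for $x\in\Gamma$, $D_a(x)$ is the disk of radius $a$ centered at $x$ and orthogonal to $\Gamma$; the fiber is $\Omega_f=\bigcup_{x\in\Gamma}D_a(x)\subset\Omega$, non-self-intersecting (in particular $a\,\kappa(s)<1$), and is the image of a straight cylinder $\Omega_a$ of radius $a$ with axis a segment $\Upsilon$ under a diffeomorphism $\Phi$ with $\Phi(\Upsilon)=\Gamma$ and $\Phi(D_a(x))=D_a(\Phi(x))$ for every $x\in\Upsilon$. $\mathcal{R}u(x)=\frac{1}{\pi a^2}\int_{D_a(x)}u\,dD$, $x\in\Gamma$, defines a bounded operator $\mathcal{R}\colon H^1(\Omega_f)^3\to W_\Gamma=H^1(\Gamma)^3$; for $v\in V$, $\mathcal{R}v$ means $\mathcal{R}(v|_{\Omega_f})$. $V=\{v\in H^1(\Omega)^3:v|_{\partial\Omega}=0\}$, $\|v\|_V=\|v\|_{L^2(\Omega)}+\|\nabla v\|_{L^2(\Omega)}$; $W_\Gamma$ carries its $H^1(\Gamma)$ norm. $Q_\Gamma=W_\Gamma'$, $\langle\cdot,\cdot\rangle$ is the duality pairing between $Q_\Gamma$ and $W_\Gamma$. $\|(v,w)\|_{\mathbb{V}}=\|v\|_V+\|w\|_{W_\Gamma}$. $V_h\subset V$ and $W_h\subset W_\Gamma$ are finite element spaces on independent regular families of meshes of $\Omega$ and $\Gamma$ (no geometrical error in the meshing), $h$ being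 the maximum element diameter; an element $q_h\in Q_h=W_h$ acts as an element of $Q_\Gamma$ through the $L^2(\Gamma)$ product: $\langle q_h,w\rangle=(q_h,w)_\Gamma$. $\nabla_\Gamma w$ is the tangential gradient: its $i$-th component gradient is $\frac{dw_i}{ds}t$, with $t$ the unit tangent and $s$ arclength. The geometric stiffness $g$ is $g(s)=\frac{1}{\pi a^2}\int_{D_a(s)}\frac{1}{1-\kappa(s)\,r\cos(\theta-\hat\theta)}\,dD$, where $dD$ is the area element, $(r,\theta)$ are polar coordinates in $D_a(s)$ and $r\cos(\theta-\hat\theta)$ is the coordinate along the principal normal of $\Gamma$; there is $C_g>0$ with $g\ge C_g$. $(\cdot,\cdot)_A$ is the $L^2(A)$ product. $\mathbb{C}_\Omega,\mathbb{C}_f$ are constant symmetric fourth-order elasticity tensors (major and minor symmetries); such a tensor $\mathbb{C}$ is strongly elliptic with constant $c>0$ if $\mathbb{C}A:A\ge c|A|^2$ for all symmetric $A\in\mathbb{R}^{3\times3}$.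
   Formalization: The difference tensor δC_f = C_f − C_Ω is additionally assumed strongly elliptic (with some positive constant); c_f > c_Ω alone does not imply this, and without it the claim can fail. *)

theory Defs
  imports "HOL-Analysis.Analysis"
begin

section \<open>Square integrable functions and test functions\<close>

definition L2 :: "'a::euclidean_space set \<Rightarrow> ('a \<Rightarrow> 'b::euclidean_space) \<Rightarrow> bool" where
  "L2 A u \<longleftrightarrow> u \<in> borel_measurable (lebesgue_on A) \<and>
     integrable (lebesgue_on A) (\<lambda>x. (norm (u x))\<^sup>2)"

definition L2_inner ::
    "'a::euclidean_space set \<Rightarrow> ('a \<Rightarrow> 'b::euclidean_space) \<Rightarrow> ('a \<Rightarrow> 'b) \<Rightarrow> real" where
  "L2_inner A u v = (LINT x|lebesgue_on A. u x \<bullet> v x)"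

definition L2_norm :: "'a::euclidean_space set \<Rightarrow> ('a \<Rightarrow> 'b::euclidean_space) \<Rightarrow> real" where
  "L2_norm A u = sqrt (LINT x|lebesgue_on A. (norm (u x))\<^sup>2)"

primrec times_diff :: "nat \<Rightarrow> ('a::euclidean_space \<Rightarrow> real) \<Rightarrow> bool" where
  "times_diff 0 f \<longleftrightarrow> continuous_on UNIV f"
| "times_diff (Suc k) f \<longleftrightarrow> (\<forall>x. f differentiable (at x)) \<and>
     (\<forall>e\<in>Basis. times_diff k (\<lambda>x. frechet_derivative f (at x) e))"

definition test_fun :: "'a::euclidean_space set \<Rightarrow> ('a \<Rightarrow> real) \<Rightarrow> bool" where
  "test_fun A \<phi> \<longleftrightarrow> (\<forall>k. times_diff k \<phi>) \<and>
     compact (closure {x. \<phi> x \<noteq> 0}) \<and> closure {x. \<phi> x \<noteq> 0} \<subseteq> A"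

section \<open>Sobolev spaces of vector fields on an open subset of three-space\<close>

text \<open>Elements of Sobolev spaces are represented by functions; equality in the space is equality
  almost everywhere. The entry \<open>(i, j)\<close> of a gradient is the derivative of component \<open>i\<close> in
  direction \<open>j\<close>.\<close>

definition is_weak_grad :: "(real^3) set \<Rightarrow> (real^3 \<Rightarrow> real^3) \<Rightarrow> (real^3 \<Rightarrow> real^3^3) \<Rightarrow> bool" where
  "is_weak_grad A u G \<longleftrightarrow> (\<forall>\<phi> i j. test_fun A \<phi> \<longrightarrow>
     (LINT x|lebesgue_on A. u x $ i * frechet_derivative \<phi> (at x) (axis j 1)) =
     - (LINT x|lebesgue_on A. G x $ i $ j * \<phi> x))"

definition H1 :: "(real^3) set \<Rightarrow> (real^3 \<Rightarrow> real^3) set" where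
  "H1 A = {u. L2 A u \<and> (\<exists>G. L2 A G \<and> is_weak_grad A u G)}"

definition wgrad :: "(real^3) set \<Rightarrow> (real^3 \<Rightarrow> real^3) \<Rightarrow> real^3 \<Rightarrow> real^3^3" where
  "wgrad A u = (SOME G. L2 A G \<and> is_weak_grad A u G)"

definition H1_norm :: "(real^3) set \<Rightarrow> (real^3 \<Rightarrow> real^3) \<Rightarrow> real" where
  "H1_norm A u = L2_norm A u + L2_norm A (wgrad A u)"

text \<open>The space of \<open>H\<^sup>1\<close> fields with zero boundary values: the closure of the smooth compactly
  supported fields in \<open>H\<^sup>1\<close>.\<close>

definition H1_zero :: "(real^3) set \<Rightarrow> (real^3 \<Rightarrow> real^3) set" where
  "H1_zero A = {u \<in> H1 A. \<exists>\<phi> :: nat \<Rightarrow> real^3 \<Rightarrow> real^3.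
     (\<forall>k i. test_fun A (\<lambda>x. \<phi> k x $ i)) \<and>
     (\<lambda>k. L2_norm A (\<lambda>x. u x - \<phi> k x)) \<longlonglongrightarrow> 0 \<and>
     (\<lambda>k. L2_norm A (\<lambda>x. wgrad A u x - jacobian (\<phi> k) (at x))) \<longlonglongrightarrow> 0}"

text \<open>A Lipschitz boundary: near each of its points the set is, in suitable orthonormal
  coordinates, the region strictly above the graph of a Lipschitz function.\<close>

definition lipschitz_boundary :: "(real^3) set \<Rightarrow> bool" where
  "lipschitz_boundary A \<longleftrightarrow> (\<forall>x\<in>frontier A. \<exists>U. \<exists>Q :: real^3 \<Rightarrow> real^3. \<exists>\<psi> :: real^2 \<Rightarrow> real. \<exists>C.
     open U \<and> x \<in> U \<and> orthogonal_transformation Q \<and> C-lipschitz_on UNIV \<psi> \<and>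
     A \<inter> U = {y\<in>U. \<psi> (vector [Q y $ 1, Q y $ 2]) < Q y $ 3})"

definition lipschitz_domain :: "(real^3) set \<Rightarrow> bool" where
  "lipschitz_domain A \<longleftrightarrow>
     A \<noteq> {} \<and> open A \<and> connected A \<and> bounded A \<and> lipschitz_boundary A"

section \<open>Sobolev space on the curve\<close>

text \<open>Functions on the curve are functions of its arclength parameter in \<open>(0, L)\<close>.\<close>

definition is_weak_deriv :: "real \<Rightarrow> (real \<Rightarrow> real^3) \<Rightarrow> (real \<Rightarrow> real^3) \<Rightarrow> bool" where
  "is_weak_deriv L w w' \<longleftrightarrow> (\<forall>\<phi>. test_fun {0<..<L} \<phi> \<longrightarrow>
     (LINT s|lebesgue_on {0<..<L}. frechet_derivative \<phi> (at s) 1 *\<^sub>R w s) =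
     - (LINT s|lebesgue_on {0<..<L}. \<phi> s *\<^sub>R w' s))"

definition H1_curve :: "real \<Rightarrow> (real \<Rightarrow> real^3) set" where
  "H1_curve L = {w. L2 {0<..<L} w \<and> (\<exists>w'. L2 {0<..<L} w' \<and> is_weak_deriv L w w')}"

definition wderiv :: "real \<Rightarrow> (real \<Rightarrow> real^3) \<Rightarrow> real \<Rightarrow> real^3" where
  "wderiv L w = (SOME w'. L2 {0<..<L} w' \<and> is_weak_deriv L w w')"

text \<open>Tangential gradient; \<open>t\<close> is the unit tangent.\<close>

definition tgrad :: "real \<Rightarrow> (real \<Rightarrow> real^3) \<Rightarrow> (real \<Rightarrow> real^3) \<Rightarrow> real \<Rightarrow> real^3^3" where
  "tgrad L t w s = (\<chi> i j. wderiv L w s $ i * t s $ j)"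

definition H1_curve_norm :: "real \<Rightarrow> (real \<Rightarrow> real^3) \<Rightarrow> real" where
  "H1_curve_norm L w = sqrt ((L2_norm {0<..<L} w)\<^sup>2 + (L2_norm {0<..<L} (wderiv L w))\<^sup>2)"

section \<open>The fiber\<close>

text \<open>A curve \<open>\<gamma>\<close> of length \<open>L\<close>, parametrised by arclength, with unit tangent \<open>t\<close>, principal
  normal \<open>n\<close>, binormal \<open>b\<close>, and curvature \<open>\<kappa>\<close> and torsion \<open>\<tau>\<close> given almost everywhere by the
  Frenet equations. Where the curvature vanishes, \<open>n\<close> may be any unit normal for which they hold;
  on the exceptional null set, \<open>n\<close> is an arbitrary unit normal.\<close>

definition frenet_curve :: "real \<Rightarrow> (real \<Rightarrow> real^3) \<Rightarrow> (real \<Rightarrow> real^3) \<Rightarrow> (real \<Rightarrow> real^3) \<Rightarrow>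
    (real \<Rightarrow> real^3) \<Rightarrow> (real \<Rightarrow> real) \<Rightarrow> (real \<Rightarrow> real) \<Rightarrow> bool" where
  "frenet_curve L \<gamma> t n b \<kappa> \<tau> \<longleftrightarrow>
     (\<forall>s\<in>{0..L}. (\<gamma> has_vector_derivative t s) (at s within {0..L})) \<and>
     continuous_on {0..L} t \<and>
     (\<forall>s\<in>{0..L}. norm (t s) = 1 \<and> norm (n s) = 1 \<and> t s \<bullet> n s = 0 \<and> b s = cross3 (t s) (n s)) \<and>
     (AE s in lebesgue_on {0<..<L}. \<kappa> s \<ge> 0 \<and>
        (t has_vector_derivative \<kappa> s *\<^sub>R n s) (at s) \<and>
        (n has_vector_derivative - \<kappa> s *\<^sub>R t s + \<tau> s *\<^sub>R b s) (at s) \<and>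
        (b has_vector_derivative - \<tau> s *\<^sub>R n s) (at s))"

definition disk :: "real \<Rightarrow> real^3 \<Rightarrow> real^3 \<Rightarrow> (real^3) set" where
  "disk a x \<nu> = {y. dist x y < a \<and> (y - x) \<bullet> \<nu> = 0}"

definition fiber :: "real \<Rightarrow> real \<Rightarrow> (real \<Rightarrow> real^3) \<Rightarrow> (real \<Rightarrow> real^3) \<Rightarrow> (real^3) set" where
  "fiber L a \<gamma> t = (\<Union>s\<in>{0..L}. disk a (\<gamma> s) (t s))"

definition straight_cylinder :: "real \<Rightarrow> real^3 \<Rightarrow> real^3 \<Rightarrow> (real^3) set" where
  "straight_cylinder a p q = (\<Union>x\<in>closed_segment p q. disk a x (q - p))"

definition diffeomorphism_on ::
    "(real^3) set \<Rightarrow> (real^3) set \<Rightarrow> (real^3 \<Rightarrow> real^3) \<Rightarrow> bool" where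
  "diffeomorphism_on A B \<Phi> \<longleftrightarrow> (\<exists>\<Psi> D E.
     \<Phi> ` A = B \<and> \<Psi> ` B = A \<and> (\<forall>x\<in>A. \<Psi> (\<Phi> x) = x) \<and> (\<forall>y\<in>B. \<Phi> (\<Psi> y) = y) \<and>
     (\<forall>x\<in>A. (\<Phi> has_derivative blinfun_apply (D x)) (at x within A)) \<and> continuous_on A D \<and>
     (\<forall>y\<in>B. (\<Psi> has_derivative blinfun_apply (E y)) (at y within B)) \<and> continuous_on B E)"

definition straightens_fiber :: "real \<Rightarrow> real \<Rightarrow> (real \<Rightarrow> real^3) \<Rightarrow> (real \<Rightarrow> real^3) \<Rightarrow>
    real^3 \<Rightarrow> real^3 \<Rightarrow> (real^3 \<Rightarrow> real^3) \<Rightarrow> bool" where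
  "straightens_fiber L a \<gamma> t p q \<Phi> \<longleftrightarrow> p \<noteq> q \<and>
     diffeomorphism_on (straight_cylinder a p q) (fiber L a \<gamma> t) \<Phi> \<and>
     \<Phi> ` closed_segment p q = \<gamma> ` {0..L} \<and>
     (\<forall>x\<in>closed_segment p q. \<exists>s\<in>{0..L}. \<Phi> x = \<gamma> s \<and>
        \<Phi> ` disk a x (q - p) = disk a (\<gamma> s) (t s))"

definition fiber_geometry :: "(real^3) set \<Rightarrow> real \<Rightarrow> real \<Rightarrow> (real \<Rightarrow> real^3) \<Rightarrow> (real \<Rightarrow> real^3) \<Rightarrow>
    (real \<Rightarrow> real^3) \<Rightarrow> (real \<Rightarrow> real^3) \<Rightarrow> (real \<Rightarrow> real) \<Rightarrow> (real \<Rightarrow> real) \<Rightarrow>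
    real^3 \<Rightarrow> real^3 \<Rightarrow> (real^3 \<Rightarrow> real^3) \<Rightarrow> bool" where
  "fiber_geometry \<Omega> L a \<gamma> t n b \<kappa> \<tau> p q \<Phi> \<longleftrightarrow>
     0 < L \<and> 0 < a \<and> frenet_curve L \<gamma> t n b \<kappa> \<tau> \<and>
     fiber L a \<gamma> t \<subseteq> \<Omega> \<and>
     (\<forall>s\<in>{0..L}. \<forall>s'\<in>{0..L}. s \<noteq> s' \<longrightarrow> disk a (\<gamma> s) (t s) \<inter> disk a (\<gamma> s') (t s') = {}) \<and>
     (AE s in lebesgue_on {0<..<L}. a * \<kappa> s < 1) \<and>
     straightens_fiber L a \<gamma> t p q \<Phi>"

text \<open>Mean over the disk of radius \<open>a\<close>, in Cartesian coordinates of its plane. The coordinates are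
  taken along \<open>n\<close> and \<open>b\<close>, so the first one is the coordinate along the principal normal.\<close>

definition disk_mean :: "real \<Rightarrow> (real^2 \<Rightarrow> 'b::euclidean_space) \<Rightarrow> 'b" where
  "disk_mean a f = (1 / (pi * a\<^sup>2)) *\<^sub>R (LINT y|lebesgue_on (ball 0 a). f y)"

definition averaging :: "real \<Rightarrow> (real \<Rightarrow> real^3) \<Rightarrow> (real \<Rightarrow> real^3) \<Rightarrow> (real \<Rightarrow> real^3) \<Rightarrow>
    (real^3 \<Rightarrow> real^3) \<Rightarrow> real \<Rightarrow> real^3" where
  "averaging a \<gamma> n b u s = disk_mean a (\<lambda>y. u (\<gamma> s + y $ 1 *\<^sub>R n s + y $ 2 *\<^sub>R b s))"

definition stiffness :: "real \<Rightarrow> (real \<Rightarrow> real) \<Rightarrow> real \<Rightarrow> real" where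
  "stiffness a \<kappa> s = disk_mean a (\<lambda>y. 1 / (1 - \<kappa> s * y $ 1))"

definition averaging_bounded :: "real \<Rightarrow> real \<Rightarrow> (real \<Rightarrow> real^3) \<Rightarrow> (real \<Rightarrow> real^3) \<Rightarrow>
    (real \<Rightarrow> real^3) \<Rightarrow> (real \<Rightarrow> real^3) \<Rightarrow> bool" where
  "averaging_bounded L a \<gamma> t n b \<longleftrightarrow> (\<exists>C. \<forall>u\<in>H1 (interior (fiber L a \<gamma> t)).
     averaging a \<gamma> n b u \<in> H1_curve L \<and>
     H1_curve_norm L (averaging a \<gamma> n b u) \<le> C * H1_norm (interior (fiber L a \<gamma> t)) u)"

section \<open>Elasticity tensors\<close>

type_synonym tensor4 = "real^3^3^3^3"

definition elasticity_tensor :: "tensor4 \<Rightarrow> bool" where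
  "elasticity_tensor T \<longleftrightarrow> (\<forall>i j k l. T $ i $ j $ k $ l = T $ k $ l $ i $ j \<and>
     T $ i $ j $ k $ l = T $ j $ i $ k $ l \<and> T $ i $ j $ k $ l = T $ i $ j $ l $ k)"

definition tensor_apply :: "tensor4 \<Rightarrow> real^3^3 \<Rightarrow> real^3^3" where
  "tensor_apply T A = (\<chi> i j. \<Sum>k\<in>UNIV. \<Sum>l\<in>UNIV. T $ i $ j $ k $ l * A $ k $ l)"

text \<open>The inner product and the norm of \<^typ>\<open>real^3^3\<close> are the Frobenius ones.\<close>

definition strongly_elliptic :: "real \<Rightarrow> tensor4 \<Rightarrow> bool" where
  "strongly_elliptic c T \<longleftrightarrow> 0 < c \<and>
     (\<forall>A. transpose A = A \<longrightarrow> tensor_apply T A \<bullet> A \<ge> c * (norm A)\<^sup>2)"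

section \<open>Meshes and finite element spaces\<close>

definition mesh :: "'a::euclidean_space set \<Rightarrow> 'a set set \<Rightarrow> bool" where
  "mesh A \<T> \<longleftrightarrow> finite \<T> \<and> \<Union>\<T> = A \<and>
     (\<forall>K\<in>\<T>. compact K \<and> connected K \<and> interior K \<noteq> {} \<and> closure (interior K) = K) \<and>
     pairwise (\<lambda>K K'. interior K \<inter> interior K' = {}) \<T>"

text \<open>Shape regularity: the elements contain balls of radius comparable to their diameter,
  uniformly over the family.\<close>

definition regular_mesh_family ::
    "'a::euclidean_space set \<Rightarrow> real set \<Rightarrow> (real \<Rightarrow> 'a set set) \<Rightarrow> bool" where
  "regular_mesh_family A H \<T> \<longleftrightarrow> (\<forall>h\<in>H. mesh A (\<T> h)) \<and>
     (\<exists>\<sigma>>0. \<forall>h\<in>H. \<forall>K\<in>\<T> h. \<exists>x \<rho>. cball x \<rho> \<subseteq> K \<and> diameter K \<le> \<sigma> * \<rho>)"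

text \<open>A conforming finite element space in \<open>X\<close>: a linear subspace whose members coincide, on every
  element \<open>K\<close> of the mesh, with members of a local space of finite dimension (the span of \<open>B\<close>).\<close>

definition finite_element_space :: "('a::euclidean_space \<Rightarrow> 'b::euclidean_space) set \<Rightarrow>
    'a set set \<Rightarrow> ('a \<Rightarrow> 'b) set \<Rightarrow> bool" where
  "finite_element_space X \<T> S \<longleftrightarrow> S \<subseteq> X \<and> (\<lambda>x. 0) \<in> S \<and>
     (\<forall>u\<in>S. \<forall>v\<in>S. \<forall>c d. (\<lambda>x. c *\<^sub>R u x + d *\<^sub>R v x) \<in> S) \<and>
     (\<forall>K\<in>\<T>. \<exists>B. finite B \<and>
        (\<forall>v\<in>S. \<exists>c. AE x in lebesgue_on K. v x = (\<Sum>\<beta>\<in>B. c \<beta> *\<^sub>R \<beta> x)))"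

section \<open>The discrete problem\<close>

text \<open>\<open>Q\<^sub>h = W\<^sub>h\<close>, and \<open>q\<close> acts on functions on the curve through the \<open>L\<^sup>2\<close> product.\<close>

definition discrete_kernel :: "real \<Rightarrow> real \<Rightarrow> (real \<Rightarrow> real^3) \<Rightarrow> (real \<Rightarrow> real^3) \<Rightarrow>
    (real \<Rightarrow> real^3) \<Rightarrow> (real^3 \<Rightarrow> real^3) set \<Rightarrow> (real \<Rightarrow> real^3) set \<Rightarrow>
    ((real^3 \<Rightarrow> real^3) \<times> (real \<Rightarrow> real^3)) set" where
  "discrete_kernel L a \<gamma> n b Vh Wh = {(v, w). v \<in> Vh \<and> w \<in> Wh \<and>
     (\<forall>q\<in>Wh. L2_inner {0<..<L} q (\<lambda>s. averaging a \<gamma> n b v s - w s) = 0)}"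

definition zero_pairs :: "(real^3) set \<Rightarrow> real \<Rightarrow> ((real^3 \<Rightarrow> real^3) \<times> (real \<Rightarrow> real^3)) set" where
  "zero_pairs \<Omega> L = {(v, w). (AE x in lebesgue_on \<Omega>. v x = 0) \<and>
     (AE s in lebesgue_on {0<..<L}. w s = 0)}"

definition pair_norm :: "(real^3) set \<Rightarrow> real \<Rightarrow> (real^3 \<Rightarrow> real^3) \<Rightarrow> (real \<Rightarrow> real^3) \<Rightarrow> real" where
  "pair_norm \<Omega> L v w = H1_norm \<Omega> v + H1_curve_norm L w"

definition elastic_form :: "(real^3) set \<Rightarrow> real \<Rightarrow> real \<Rightarrow> (real \<Rightarrow> real^3) \<Rightarrow> (real \<Rightarrow> real) \<Rightarrow>
    tensor4 \<Rightarrow> tensor4 \<Rightarrow> (real^3 \<Rightarrow> real^3) \<Rightarrow> (real \<Rightarrow> real^3) \<Rightarrow>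
    (real^3 \<Rightarrow> real^3) \<Rightarrow> (real \<Rightarrow> real^3) \<Rightarrow> real" where
  "elastic_form \<Omega> L c\<^sub>\<Gamma> t g C\<^sub>\<Omega> \<delta>C v y u w =
     L2_inner \<Omega> (\<lambda>x. tensor_apply C\<^sub>\<Omega> (wgrad \<Omega> v x)) (wgrad \<Omega> u) +
     c\<^sub>\<Gamma> * L2_inner {0<..<L} (\<lambda>s. g s *\<^sub>R tensor_apply \<delta>C (tgrad L t y s)) (tgrad L t w)"

end

theory Submission
  imports Defs "HOL-Computational_Algebra.Polynomial"
begin

text \<open>Testing with \<open>(v, y) = (u, w)\<close> reduces the claim to coercivity on the discrete kernel. Korn's
  first inequality and Poincare's inequality bound the \<open>H\<^sup>1\<close> norm of \<open>u\<close> by the elastic energy in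
  \<open>\<Omega>\<close>; the fiber energy bounds only the derivative of \<open>w\<close>, since \<open>2\<close> times the squared norm of the
  symmetric part of \<open>w' \<otimes> t\<close> is \<open>|w'|\<^sup>2 + (w' \<bullet> t)\<^sup>2\<close>. As \<open>Q\<^sub>h = W\<^sub>h\<close>, the constraint says that
  \<open>w\<close> is the \<open>L\<^sup>2\<close> projection of \<open>\<R>u\<close> onto \<open>W\<^sub>h\<close>, so \<open>w\<close> itself is bounded by \<open>u\<close>, uniformly in the
  mesh. The weak gradient on the fiber is the restriction of the one on \<open>\<Omega>\<close> only almost everywhere,
  whence the fundamental lemma of the calculus of variations. The stiffness must be shown to be
  measurable and bounded above, as otherwise the energy integral could be the junk value \<open>0\<close>.\<close>

section \<open>Smooth bump functions\<close>

text \<open>The inequality \<open>c\<^sub>f > c\<^sub>\<Omega>\<close> compares only lower bounds of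
  the two tensors and does not order them: \<open>C\<^sub>\<Omega>\<close> may still exceed
  \<open>C\<^sub>f\<close> on some strain. Positivity of the fiber energy therefore rests on the
  separate assumption \<open>stiffer_fiber\<close>, and its constant \<open>c\<close> enters the
  final bound. Both inequalities on \<Omega> are proved for test fields first. These extend by zero
  to the whole space, where Lebesgue measure is translation invariant, so integration by parts
  becomes a translation of difference quotients followed by a limit. Zero boundary values are
  defined through approximation by test fields in the norms of u and of its gradient, which is what
  carries the inequalities over. The radius \<open>R\<close> of a ball containing \<Omega>, the
  averaging bound \<open>K\<close>, \<open>C\<^sub>g\<close>, \<open>c\<^sub>\<Omega>\<close>,
  \<open>c\<close> and \<open>a\<close> make up the final constant; all are fixed before the mesh is
  chosen.\<close>

definition flat_exp :: "real poly \<Rightarrow> real \<Rightarrow> real" where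
  "flat_exp p x = (if x > 0 then poly p (1 / x) * exp (- (1 / x)) else 0)"

lemma poly_times_exp_tendsto_0: "((\<lambda>x. poly p x * exp (- x)) \<longlongrightarrow> (0::real)) at_top"
proof -
  have "((\<lambda>x. \<Sum>i\<le>degree p. coeff p i * (x ^ i / exp x)) \<longlongrightarrow> (\<Sum>i\<le>degree p. coeff p i * 0)) at_top"
    by (intro tendsto_sum tendsto_mult tendsto_const tendsto_power_div_exp_0)
  then show ?thesis
    by (simp add: poly_altdef exp_minus divide_inverse sum_distrib_right mult.assoc)
qed

text \<open>With u = 1 / x, the derivative of p(u) exp(-u) is u^2 (p - p')(u) exp(-u); hence the
  factor \<open>[:0, 0, 1:]\<close> and the term \<open>p - pderiv p\<close>. The polynomial
  parameter makes the family closed under differentiation, also at the flat point 0.\<close>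

lemma flat_exp_has_field_derivative:
  "(flat_exp p has_field_derivative flat_exp ([:0, 0, 1:] * (p - pderiv p)) x) (at x)"
proof -
  consider "x > 0" | "x < 0" | "x = 0" by linarith
  then show ?thesis
  proof cases
    case 1
    have "((\<lambda>x. poly p (1 / x) * exp (- (1 / x))) has_field_derivative
            flat_exp ([:0, 0, 1:] * (p - pderiv p)) x) (at x)"
      using 1 by (auto intro!: derivative_eq_intros
          simp: flat_exp_def field_simps power2_eq_square)
    moreover have "eventually (\<lambda>y. y > 0) (nhds x)"
      using 1 eventually_nhds_in_open[of "{0<..}" x] by simp
    then have "eventually (\<lambda>y. flat_exp p y = poly p (1 / y) * exp (- (1 / y))) (nhds x)"
      by eventually_elim (simp add: flat_exp_def)
    ultimately show ?thesis
      by (subst DERIV_cong_ev[OF refl _ refl]) auto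
  next
    case 2
    have "eventually (\<lambda>y. y < 0) (nhds x)"
      using 2 eventually_nhds_in_open[of "{..<0}" x] by simp
    then have "eventually (\<lambda>y. flat_exp p y = 0) (nhds x)"
      by eventually_elim (simp add: flat_exp_def)
    then show ?thesis
      using 2 by (subst DERIV_cong_ev[OF refl _ refl]) (auto simp: flat_exp_def)
  next
    case 3
    have "((\<lambda>h. flat_exp p h / h) \<longlongrightarrow> 0) (at_left 0)"
      by (rule tendsto_eventually) (auto simp: eventually_at_filter flat_exp_def)
    moreover have "((\<lambda>h. flat_exp p h / h) \<longlongrightarrow> 0) (at_right 0)"
    proof -
      \<comment> \<open>Dividing by h adds one power of 1 / h, hence \<open>pCons 0 p\<close>; the
        exponential decay still wins.\<close>
      have "((\<lambda>h. poly (pCons 0 p) (inverse h) * exp (- inverse h)) \<longlongrightarrow> 0) (at_right (0::real))"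
        by (rule filterlim_compose[OF poly_times_exp_tendsto_0 filterlim_inverse_at_top_right])
      moreover have "eventually (\<lambda>h. flat_exp p h / h = poly (pCons 0 p) (inverse h) * exp (- inverse h)) (at_right 0)"
        by (auto simp: eventually_at_filter flat_exp_def divide_inverse)
      ultimately show ?thesis
        by (simp add: tendsto_cong)
    qed
    ultimately show ?thesis
      using 3 by (simp add: has_field_derivative_iff flat_exp_def filterlim_split_at)
  qed
qed

section \<open>Closure properties of iterated differentiability\<close>

lemma times_diff_SucD: "times_diff (Suc k) f \<Longrightarrow> times_diff k f"
proof (induction k arbitrary: f)
  case 0
  then show ?case
    by (simp add: continuous_at_imp_continuous_on differentiable_imp_continuous_within)
qed auto

lemma frechet_derivative_apply:
  "(f has_derivative f') (at x) \<Longrightarrow> frechet_derivative f (at x) e = f' e"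
  by (simp add: frechet_derivative_at[symmetric])

lemma times_diff_const: "times_diff k (\<lambda>x. c)"
proof (induction k arbitrary: c)
  case (Suc k)
  have "frechet_derivative (\<lambda>x::'a. c) (at x) e = 0" for x e
    by (rule frechet_derivative_apply) (auto intro!: derivative_eq_intros)
  then show ?case using Suc by simp
qed auto

lemma times_diff_add: "times_diff k f \<Longrightarrow> times_diff k g \<Longrightarrow> times_diff k (\<lambda>x. f x + g x)"
proof (induction k arbitrary: f g)
  case (Suc k)
  have "frechet_derivative (\<lambda>x. f x + g x) (at x) e =
      frechet_derivative f (at x) e + frechet_derivative g (at x) e" for x e
    by (rule frechet_derivative_apply)
      (use Suc.prems in \<open>auto intro!: has_derivative_add simp: frechet_derivative_works[symmetric]\<close>)
  then show ?case using Suc by auto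
qed (auto intro!: continuous_intros)

lemma frechet_derivative_mult:
  fixes f g :: "'a::real_normed_vector \<Rightarrow> real"
  assumes "f differentiable at x" "g differentiable at x"
  shows "frechet_derivative (\<lambda>x. f x * g x) (at x) e =
    f x * frechet_derivative g (at x) e + frechet_derivative f (at x) e * g x"
  by (rule frechet_derivative_apply)
    (use assms in \<open>auto intro!: has_derivative_mult simp: frechet_derivative_works[symmetric]\<close>)

lemma times_diff_mult: "times_diff k f \<Longrightarrow> times_diff k g \<Longrightarrow> times_diff k (\<lambda>x. f x * g x)"
proof (induction k arbitrary: f g)
  case (Suc k)
  then show ?case
    using times_diff_SucD[OF Suc.prems(1)] times_diff_SucD[OF Suc.prems(2)]
    by (auto simp: frechet_derivative_mult intro!: times_diff_add)
qed (auto intro!: continuous_intros)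

lemma times_diff_prod:
  "finite I \<Longrightarrow> (\<And>i. i \<in> I \<Longrightarrow> times_diff k (f i)) \<Longrightarrow> times_diff k (\<lambda>x. \<Prod>i\<in>I. f i x)"
  by (induction I rule: finite_induct) (auto intro: times_diff_mult times_diff_const)

text \<open>A directional derivative contributes the scalar \<open>e \<bullet> v\<close>, which
  \<open>smult\<close> absorbs into the polynomial, so an induction generalised over
  \<open>p\<close> stays within the family.\<close>

lemma times_diff_flat_exp: "times_diff k (\<lambda>x. flat_exp p (x \<bullet> v + d))"
proof (induction k arbitrary: p)
  case 0
  have "continuous_on UNIV (flat_exp p)"
    by (intro continuous_at_imp_continuous_on ballI DERIV_isCont[OF flat_exp_has_field_derivative])
  moreover have "continuous_on UNIV (\<lambda>x. x \<bullet> v + d)"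
    by (intro continuous_intros)
  ultimately have "continuous_on UNIV (\<lambda>x. flat_exp p (x \<bullet> v + d))"
    using continuous_on_compose2 by blast
  then show ?case by simp
next
  case (Suc k)
  obtain q where q: "\<And>x. (flat_exp p has_field_derivative flat_exp q x) (at x)"
    using flat_exp_has_field_derivative by blast
  have deriv: "((\<lambda>x. flat_exp p (x \<bullet> v + d)) has_derivative
      (\<lambda>e. flat_exp (smult (e \<bullet> v) q) (x \<bullet> v + d))) (at x)" for x
  proof -
    have "((\<lambda>x. x \<bullet> v + d) has_derivative (\<lambda>e. e \<bullet> v)) (at x)"
      by (auto intro!: derivative_eq_intros)
    from DERIV_compose_FDERIV[OF q this] show ?thesis
      by (rule has_derivative_eq_rhs) (simp add: flat_exp_def fun_eq_iff mult.assoc)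
  qed
  then have "(\<lambda>x. flat_exp p (x \<bullet> v + d)) differentiable (at x)" for x
    unfolding differentiable_def by blast
  then show ?case
    by (simp add: frechet_derivative_apply[OF deriv] Suc.IH)
qed

text \<open>Two one-sided factors per coordinate. At a signed distance c from a face, the factor is
  exp(-1 / ((n + 1) c)) for c > 0 and 0 otherwise, so the products are smooth, lie in [0, 1] and
  converge pointwise to the indicator of the open box.\<close>

definition box_bump :: "'a::euclidean_space \<Rightarrow> 'a \<Rightarrow> nat \<Rightarrow> 'a \<Rightarrow> real" where
  "box_bump a b n x = (\<Prod>i\<in>Basis. flat_exp 1 (real (Suc n) * ((x - a) \<bullet> i)) *
     flat_exp 1 (real (Suc n) * ((b - x) \<bullet> i)))"

lemma flat_exp_1_bounds: "0 \<le> flat_exp 1 x" "flat_exp 1 x \<le> 1"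
  by (auto simp: flat_exp_def)

lemma box_bump_bounds: "0 \<le> box_bump a b n x" "box_bump a b n x \<le> 1"
  unfolding box_bump_def
  by (auto intro!: prod_nonneg prod_le_1 mult_nonneg_nonneg mult_le_one flat_exp_1_bounds)

lemma box_bump_eq_0: "x \<notin> box a b \<Longrightarrow> box_bump a b n x = 0"
proof -
  assume "x \<notin> box a b"
  then obtain i where i: "i \<in> Basis" "x \<bullet> i \<le> a \<bullet> i \<or> b \<bullet> i \<le> x \<bullet> i"
    by (auto simp: box_def not_less)
  then have "flat_exp 1 (real (Suc n) * ((x - a) \<bullet> i)) * flat_exp 1 (real (Suc n) * ((b - x) \<bullet> i)) = 0"
    by (auto simp: flat_exp_def zero_less_mult_iff inner_diff_left)
  then show ?thesis
    using i unfolding box_bump_def by (intro prod_zero) auto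
qed

lemma box_bump_tendsto: "(\<lambda>n. box_bump a b n x) \<longlonglongrightarrow> indicator (box a b) x"
proof (cases "x \<in> box a b")
  case True
  have *: "(\<lambda>n. flat_exp 1 (real (Suc n) * c)) \<longlonglongrightarrow> 1" if "c > 0" for c
  proof -
    have "(\<lambda>n. exp (- (inverse (real (Suc n)) * inverse c))) \<longlonglongrightarrow> exp (- (0 * inverse c))"
      by (intro tendsto_intros LIMSEQ_inverse_real_of_nat)
    moreover have "flat_exp 1 (real (Suc n) * c) = exp (- (inverse (real (Suc n)) * inverse c))" for n
      using that by (simp add: flat_exp_def field_simps zero_less_mult_iff add_pos_nonneg)
    ultimately show ?thesis by simp
  qed
  have "(\<lambda>n. box_bump a b n x) \<longlonglongrightarrow> (\<Prod>i\<in>(Basis::'a set). 1 * 1)"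
    unfolding box_bump_def
    using True by (intro tendsto_prod tendsto_mult *) (auto simp: box_def inner_diff_left)
  then show ?thesis using True by simp
qed (simp add: box_bump_eq_0)

lemma test_fun_box_bump:
  assumes "cbox a b \<subseteq> A"
  shows "test_fun A (box_bump a b n)"
proof -
  have *: "real (Suc n) * ((x - a) \<bullet> i) = x \<bullet> (real (Suc n) *\<^sub>R i) + - (real (Suc n) * (a \<bullet> i))"
     "real (Suc n) * ((b - x) \<bullet> i) = x \<bullet> (- real (Suc n) *\<^sub>R i) + real (Suc n) * (b \<bullet> i)" for x i
    by (simp_all add: inner_diff_left algebra_simps)
  have "times_diff k (box_bump a b n)" for k
    unfolding box_bump_def * by (intro times_diff_prod times_diff_mult times_diff_flat_exp) auto
  moreover have sub: "closure {x. box_bump a b n x \<noteq> 0} \<subseteq> cbox a b"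
    using box_bump_eq_0[of _ a b n] box_subset_cbox[of a b] by (intro closure_minimal) (auto simp: closed_cbox)
  moreover from sub have "compact (closure {x. box_bump a b n x \<noteq> 0})"
    by (meson bounded_cbox bounded_subset closed_closure compact_eq_bounded_closed)
  ultimately show ?thesis
    using assms by (auto simp: test_fun_def)
qed

section \<open>The fundamental lemma of the calculus of variations\<close>

lemma integral_translation_lborel:
  fixes f :: "'a::euclidean_space \<Rightarrow> 'b::{banach, second_countable_topology}"
  assumes "f \<in> borel_measurable borel"
  shows "(LINT x|lborel. f (x + c)) = (LINT x|lborel. f x)"
proof -
  have "(LINT x|lborel. f x) = (LINT x|distr lborel borel ((+) c). f x)"
    by (simp add: lborel_distr_plus)
  also have "\<dots> = (LINT x|lborel. f (c + x))"
    by (rule integral_distr) (use assms in auto)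
  finally show ?thesis by (simp add: add.commute)
qed

lemma integrable_translation_lborel:
  fixes f :: "'a::euclidean_space \<Rightarrow> 'b::{banach, second_countable_topology}"
  assumes "integrable lborel f"
  shows "integrable lborel (\<lambda>x. f (x + c))"
proof -
  have "integrable (distr lborel borel ((+) c)) f"
    using assms by (simp add: lborel_distr_plus)
  then have "integrable lborel (\<lambda>x. f (c + x))"
    by (rule integrable_distr[rotated]) simp
  then show ?thesis by (simp add: add.commute)
qed

text \<open>Dynkin's argument: open boxes are stable under intersection and generate the Borel sets.
  The complement step subtracts from the total integral, which is why that is assumed to vanish as
  well.\<close>

lemma integral_zero_on_boxes_imp_AE_zero:
  fixes f :: "'a::euclidean_space \<Rightarrow> real"
  assumes int: "integrable lebesgue f"
    and "(LINT x|lebesgue. f x) = 0"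
    and box: "\<And>a b. (LINT x|lebesgue. indicator (box a b) x * f x) = 0"
  shows "AE x in lebesgue. f x = 0"
proof (rule density_unique_real[OF int])
  have borel: "set_lebesgue_integral lebesgue B f = 0" if "B \<in> sets borel" for B
  proof -
    have B: "B \<in> sigma_sets UNIV (range (\<lambda>(a, b). box a b))"
      using that by (simp add: borel_eq_box)
    have sub: "X \<in> sigma_sets UNIV (range (\<lambda>(a, b). box a b :: 'a set)) \<Longrightarrow> X \<in> sets lebesgue" for X
      using sets_completionI_sets[of X lborel] by (simp add: borel_eq_box)
    have int': "set_integrable lebesgue X f" if "X \<in> sets lebesgue" for X
      unfolding set_integrable_def using int that by (rule integrable_mult_indicator[rotated])
    have stable: "Int_stable (range (\<lambda>(a, b). box a b :: 'a set))"
      by (auto simp: Int_stable_def box_Int_box)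
    have "range (\<lambda>(a, b). box a b) \<subseteq> Pow (UNIV :: 'a set)" by simp
    from stable this B show ?thesis
    proof (induct rule: sigma_sets_induct_disjoint)
      case (basic X)
      then show ?case using box by (auto simp: set_lebesgue_integral_def)
    next
      case empty
      show ?case by (simp add: set_lebesgue_integral_def)
    next
      case (compl X)
      have "set_lebesgue_integral lebesgue (X \<union> (UNIV - X)) f =
          set_lebesgue_integral lebesgue X f + set_lebesgue_integral lebesgue (UNIV - X) f"
        using sub[OF compl(1)] by (intro set_integral_Un int') (auto simp: Compl_in_sets_lebesgue Compl_eq_Diff_UNIV[symmetric])
      then show ?case
        using compl assms(2) by (simp add: set_lebesgue_integral_def)
    next
      case (union X)
      have "X n \<in> sets lebesgue" for n using union sub by blast
      moreover from this have "set_integrable lebesgue (\<Union>n. X n) f"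
        by (intro int') auto
      ultimately have "set_lebesgue_integral lebesgue (\<Union>n. X n) f =
          (\<Sum>n. set_lebesgue_integral lebesgue (X n) f)"
        using union by (intro lebesgue_integral_countable_add) (auto simp: disjoint_family_on_def)
      then show ?case using union by simp
    qed
  qed
  fix S :: "'a set" assume S: "S \<in> sets lebesgue"
  \<comment> \<open>A Lebesgue set differs from its Borel \<open>main_part\<close> by a null set, so
    the Borel case is enough.\<close>
  have "AE x in lebesgue. x \<in> main_part lborel S \<longleftrightarrow> x \<in> S"
    using AE_in_main_part[OF S] by (rule AE_completion)
  moreover have m: "main_part lborel S \<in> sets lebesgue"
    using main_part_sets[OF S] by (rule sets_completionI_sets)
  ultimately have "set_lebesgue_integral lebesgue S f = set_lebesgue_integral lebesgue (main_part lborel S) f"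
    unfolding set_lebesgue_integral_def using S int
    by (intro integral_cong_AE) (auto simp: indicator_def)
  then show "set_lebesgue_integral lebesgue S f = set_lebesgue_integral lebesgue S (\<lambda>x. 0)"
    using borel main_part_sets[OF S] by (simp add: set_lebesgue_integral_def)
qed simp

text \<open>Dominated convergence carries the hypothesis from bumps to indicators of boxes whose
  closed hull lies in A. This gives f = 0 almost everywhere on each such closed box, and countably
  many of them cover A.\<close>

lemma fundamental_lemma_calculus_of_variations:
  fixes f :: "'a::euclidean_space \<Rightarrow> real"
  assumes A: "open A" and int: "integrable (lebesgue_on A) f"
    and test: "\<And>\<phi>. test_fun A \<phi> \<Longrightarrow> (LINT x|lebesgue_on A. f x * \<phi> x) = 0"
  shows "AE x in lebesgue_on A. f x = 0"
proof -
  have Am: "A \<in> sets lebesgue" using A by (simp add: borel_open)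
  define F where "F = (\<lambda>x. indicator A x * f x)"
  have F: "integrable lebesgue F"
    using int Am by (simp add: F_def integrable_restrict_space)
  have box: "(LINT x|lebesgue. indicator (box a b) x * F x) = 0" if "cbox a b \<subseteq> A" for a b
  proof -
    have "(\<lambda>n. LINT x|lebesgue. box_bump a b n x * F x) \<longlonglongrightarrow> (LINT x|lebesgue. indicator (box a b) x * F x)"
    proof (rule integral_dominated_convergence[where w = "\<lambda>x. norm (F x)"])
      have "continuous_on UNIV (box_bump a b n)" for n
        using test_fun_box_bump[OF that] times_diff.simps(1) unfolding test_fun_def by blast
      then show "(\<lambda>x. box_bump a b n x * F x) \<in> borel_measurable lebesgue" for n
        using F by (intro borel_measurable_times) 
          (auto intro!: measurable_completion borel_measurable_continuous_onI)
      show "(\<lambda>x. indicator (box a b) x * F x) \<in> borel_measurable lebesgue"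
        using F by (intro borel_measurable_times borel_measurable_indicator) auto
      show "AE x in lebesgue. (\<lambda>n. box_bump a b n x * F x) \<longlonglongrightarrow> indicator (box a b) x * F x"
        by (intro AE_I2 tendsto_intros box_bump_tendsto)
      show "AE x in lebesgue. norm (box_bump a b n x * F x) \<le> norm (F x)" for n
        by (intro AE_I2) (simp add: abs_mult box_bump_bounds mult_left_le_one_le)
    qed (use F in auto)
    moreover have "(LINT x|lebesgue. box_bump a b n x * F x) = 0" for n
      using test[OF test_fun_box_bump[OF that], of n] Am
      by (simp add: integral_restrict_space F_def mult_ac)
    ultimately show ?thesis by (simp add: LIMSEQ_const_iff)
  qed
  have "AE x in lebesgue. x \<in> cbox a b \<longrightarrow> F x = 0" if "cbox a b \<subseteq> A" for a b
  proof -
    have "AE x in lebesgue. indicator (box a b) x * F x = 0"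
    proof (rule integral_zero_on_boxes_imp_AE_zero)
      show "integrable lebesgue (\<lambda>x. indicator (box a b) x * F x)"
        using integrable_mult_indicator[OF _ F, of "box a b"] by simp
      show "(LINT x|lebesgue. indicator (box a b) x * F x) = 0"
        by (rule box[OF that])
      fix c d
      obtain u v where uv: "box c d \<inter> box a b = box u v"
        using box_Int_box by blast
      \<comment> \<open>If the intersection is empty, its corners say nothing about where
        \<open>cbox u v\<close> lies, so that case is kept apart.\<close>
      have "cbox u v \<subseteq> A \<or> box u v = {}"
      proof (cases "box u v = {}")
        case False
        then have "cbox u v = closure (box u v)" by (simp add: closure_box)
        also have "\<dots> \<subseteq> closure (box a b)" using uv by (intro closure_mono) auto
        also have "\<dots> \<subseteq> cbox a b" by (intro closure_minimal box_subset_cbox closed_cbox)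
        finally show ?thesis using that by auto
      qed auto
      then have "(LINT x|lebesgue. indicator (box u v) x * F x) = 0"
        using box by auto
      then show "(LINT x|lebesgue. indicator (box c d) x * (indicator (box a b) x * F x)) = 0"
        unfolding uv[symmetric] by (simp add: indicator_inter_arith mult.assoc)
    qed
    moreover have "cbox a b - box a b \<in> null_sets lebesgue"
      using negligible_frontier_interval[of a b] by (simp add: negligible_iff_null_sets)
    then have "AE x in lebesgue. x \<notin> cbox a b - box a b"
      by (rule AE_not_in)
    ultimately show ?thesis
      by eventually_elim auto
  qed
  moreover obtain \<D> where \<D>: "countable \<D>" "\<D> \<subseteq> Pow A" "\<And>X. X \<in> \<D> \<Longrightarrow> \<exists>a b. X = cbox a b" "\<Union>\<D> = A"
    using open_countable_Union_open_cbox[OF A] by metis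
  ultimately have "\<forall>X\<in>\<D>. AE x in lebesgue. x \<in> X \<longrightarrow> F x = 0"
    by (metis Pow_iff subsetD)
  then have "AE x in lebesgue. \<forall>X\<in>\<D>. x \<in> X \<longrightarrow> F x = 0"
    by (subst AE_ball_countable[OF \<D>(1)])
  then have "AE x in lebesgue. x \<in> A \<longrightarrow> f x = 0"
    by eventually_elim (use \<D>(4) in \<open>auto simp: F_def indicator_eq_0_iff\<close>)
  then show ?thesis
    using Am by (simp add: AE_restrict_space_iff)
qed

section \<open>Integration by parts for compactly supported functions\<close>

definition compact_C1 :: "('a::euclidean_space \<Rightarrow> real) \<Rightarrow> bool" where
  "compact_C1 f \<longleftrightarrow> times_diff (Suc 0) f \<and> bounded {x. f x \<noteq> 0}"

lemma test_fun_imp_compact_C1: "test_fun A \<phi> \<Longrightarrow> compact_C1 \<phi>"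
  unfolding test_fun_def compact_C1_def
  using bounded_subset[OF compact_imp_bounded closure_subset] by blast

lemma compact_C1_mult:
  "times_diff (Suc 0) f \<Longrightarrow> compact_C1 g \<Longrightarrow> compact_C1 (\<lambda>x. f x * g x)"
  unfolding compact_C1_def
  by (auto simp del: times_diff.simps intro: times_diff_mult bounded_subset)

lemma compact_C1_differentiable: "compact_C1 f \<Longrightarrow> f differentiable (at x)"
  by (simp add: compact_C1_def)

lemma compact_C1_has_derivative:
  "compact_C1 f \<Longrightarrow> (f has_derivative frechet_derivative f (at x)) (at x)"
  by (simp add: compact_C1_differentiable frechet_derivative_works[symmetric])

lemma compact_C1_continuous: "compact_C1 f \<Longrightarrow> continuous_on UNIV f"
  by (intro continuous_at_imp_continuous_on ballI differentiable_imp_continuous_within compact_C1_differentiable)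

lemma compact_C1_continuous_derivative:
  "compact_C1 f \<Longrightarrow> e \<in> Basis \<Longrightarrow> continuous_on UNIV (\<lambda>x. frechet_derivative f (at x) e)"
  by (simp add: compact_C1_def)

lemma frechet_derivative_eq_0_outside_support:
  fixes f :: "'a::real_normed_vector \<Rightarrow> real"
  assumes "x \<notin> closure {x. f x \<noteq> 0}"
  shows "frechet_derivative f (at x) e = 0"
proof -
  have "((\<lambda>x. 0) has_derivative (\<lambda>e. 0)) (at x)" by simp
  moreover have "open (- closure {x. f x \<noteq> 0})" by (simp add: open_Compl)
  ultimately have "(f has_derivative (\<lambda>e. 0)) (at x)"
    by (rule has_derivative_transform_within_open) (use assms closure_subset[of "{x. f x \<noteq> 0}"] in auto)
  then show ?thesis by (rule frechet_derivative_apply)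
qed

lemma integrable_continuous_bounded_support:
  fixes f :: "'a::euclidean_space \<Rightarrow> real"
  assumes "continuous_on UNIV f" "bounded {x. f x \<noteq> 0}"
  shows "integrable lborel f"
proof -
  let ?K = "closure {x. f x \<noteq> 0}"
  have "compact ?K" using assms(2) by simp
  then have "integrable lborel (\<lambda>x. indicator ?K x *\<^sub>R f x)"
    using assms(1) continuous_on_subset by (intro borel_integrable_compact) auto
  moreover have "(\<lambda>x. indicator ?K x *\<^sub>R f x) = f"
    using closure_subset[of "{x. f x \<noteq> 0}"] by (fastforce simp: indicator_def)
  ultimately show ?thesis by simp
qed

lemma compact_C1_support:
  assumes "compact_C1 f"
  obtains R where "\<And>x. norm x > R \<Longrightarrow> f x = 0"
proof -
  obtain R where "\<forall>x\<in>{x. f x \<noteq> 0}. norm x \<le> R"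
    using assms unfolding compact_C1_def bounded_iff by blast
  then show ?thesis using that[of R] by fastforce
qed

lemma compact_C1_derivative_bound:
  assumes f: "compact_C1 f" and e: "e \<in> Basis"
  obtains B where "B \<ge> 0" "\<And>x. \<bar>frechet_derivative f (at x) e\<bar> \<le> B"
proof -
  let ?K = "closure {x. f x \<noteq> 0}" and ?d = "\<lambda>x. frechet_derivative f (at x) e"
  have "compact ?K" using f by (simp add: compact_C1_def)
  then have "compact (?d ` ?K)"
    using compact_C1_continuous_derivative[OF f e] by (intro compact_continuous_image) (auto elim: continuous_on_subset)
  then have "bounded (?d ` ?K)" by (rule compact_imp_bounded)
  then obtain B where B: "\<And>x. x \<in> ?K \<Longrightarrow> \<bar>?d x\<bar> \<le> B"
    unfolding bounded_iff by (metis imageI real_norm_def)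
  have "\<bar>?d x\<bar> \<le> \<bar>B\<bar>" for x
    using B[of x] frechet_derivative_eq_0_outside_support[of x f e] by (cases "x \<in> ?K") auto
  then show ?thesis by (intro that[of "\<bar>B\<bar>"]) auto
qed

section \<open>Difference quotients\<close>

definition diff_quot :: "'a::euclidean_space \<Rightarrow> ('a \<Rightarrow> real) \<Rightarrow> real \<Rightarrow> 'a \<Rightarrow> real" where
  "diff_quot e f h x = (f (x + h *\<^sub>R e) - f x) / h"

lemma line_has_derivative:
  assumes "compact_C1 f"
  shows "((\<lambda>t. f (x + t *\<^sub>R e)) has_field_derivative frechet_derivative f (at (x + t *\<^sub>R e)) e) (at t)"
proof -
  have lin: "linear (frechet_derivative f (at (x + t *\<^sub>R e)))"
    using compact_C1_has_derivative[OF assms] has_derivative_linear by blast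
  have "((\<lambda>t. x + t *\<^sub>R e) has_derivative (\<lambda>t. t *\<^sub>R e)) (at t)"
    by (auto intro!: derivative_eq_intros)
  from has_derivative_compose[OF this compact_C1_has_derivative[OF assms]]
  show ?thesis
    unfolding has_field_derivative_def
    by (rule has_derivative_eq_rhs) (simp add: fun_eq_iff linear_cmul[OF lin] mult.commute)
qed

text \<open>The mean value inequality along the line through x; being uniform in h, the bound serves
  for dominated convergence.\<close>

lemma diff_quot_bound:
  assumes "compact_C1 f" "\<And>x. \<bar>frechet_derivative f (at x) e\<bar> \<le> B" "h \<noteq> 0"
  shows "\<bar>diff_quot e f h x\<bar> \<le> B"
proof -
  have "norm (f (x + h *\<^sub>R e) - f (x + 0 *\<^sub>R e)) \<le> B * norm (h - 0)"
    by (rule field_differentiable_bound[of UNIV "\<lambda>t. f (x + t *\<^sub>R e)"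
          "\<lambda>t. frechet_derivative f (at (x + t *\<^sub>R e)) e"])
      (use assms line_has_derivative in auto)
  then show ?thesis using assms(3) by (simp add: diff_quot_def divide_le_eq)
qed

lemma diff_quot_tendsto:
  assumes "compact_C1 f" "filterlim h (at 0) sequentially"
  shows "(\<lambda>n. diff_quot e f (h n) x) \<longlonglongrightarrow> frechet_derivative f (at x) e"
proof -
  have "((\<lambda>t. (f (x + t *\<^sub>R e) - f x) / t) \<longlongrightarrow> frechet_derivative f (at x) e) (at 0)"
    using line_has_derivative[OF assms(1), of x e 0] by (simp add: has_field_derivative_iff)
  from filterlim_compose[OF this assms(2)] show ?thesis by (simp add: diff_quot_def)
qed

lemma continuous_diff_quot:
  assumes "compact_C1 f"
  shows "continuous_on UNIV (diff_quot e f h)"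
proof -
  have "continuous_on UNIV (\<lambda>x. (f (x + h *\<^sub>R e) - f x) * inverse h)"
    by (intro continuous_intros continuous_on_compose2[OF compact_C1_continuous[OF assms]]
        compact_C1_continuous[OF assms]) auto
  then show ?thesis by (simp add: diff_quot_def[abs_def] divide_inverse)
qed

lemma diff_quot_support:
  assumes "\<And>x. norm x > R \<Longrightarrow> f x = 0" "norm e = 1" "\<bar>h\<bar> \<le> 1" "x \<notin> cball 0 (R + 1)"
  shows "diff_quot e f h x = 0"
proof -
  have "norm x - norm (h *\<^sub>R e) \<le> norm (x + h *\<^sub>R e)"
    using norm_triangle_ineq4[of "x + h *\<^sub>R e" "h *\<^sub>R e"] by simp
  then show ?thesis using assms by (simp add: diff_quot_def)
qed

text \<open>The second factor \<open>G n\<close> is left general: the constant 1 yields the integral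
  of a single derivative, a difference quotient of another function yields a product of two
  derivatives.\<close>

lemma integral_diff_quot_tendsto:
  fixes f :: "'a::euclidean_space \<Rightarrow> real"
  assumes f: "compact_C1 f" and e: "e \<in> Basis"
    and h: "filterlim h (at 0) sequentially" "\<And>n. h n \<noteq> 0" "\<And>n. \<bar>h n\<bar> \<le> 1"
    and G: "\<And>n. continuous_on UNIV (G n)" "\<And>x. (\<lambda>n. G n x) \<longlonglongrightarrow> g x" "continuous_on UNIV g"
      "\<And>n x. \<bar>G n x\<bar> \<le> C"
  shows "(\<lambda>n. LINT x|lborel. diff_quot e f (h n) x * G n x) \<longlonglongrightarrow>
    (LINT x|lborel. frechet_derivative f (at x) e * g x)"
proof -
  obtain R where R: "\<And>x. norm x > R \<Longrightarrow> f x = 0" using compact_C1_support[OF f] by blast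
  obtain B where B: "B \<ge> 0" "\<And>x. \<bar>frechet_derivative f (at x) e\<bar> \<le> B"
    using compact_C1_derivative_bound[OF f e] by blast
  have C: "C \<ge> 0" using G(4)[of 0 0] by linarith
  show ?thesis
  \<comment> \<open>A translation by at most 1 enlarges the support from radius \<open>R\<close> to
    \<open>R + 1\<close>; on that ball the two factors are bounded by \<open>B\<close> and
    \<open>C\<close>.\<close>
  proof (rule integral_dominated_convergence[where w = "\<lambda>x. B * C * indicator (cball 0 (R + 1)) x"])
    show "(\<lambda>x. frechet_derivative f (at x) e * g x) \<in> borel_measurable lborel"
      using compact_C1_continuous_derivative[OF f e] G(3)
      by (simp add: borel_measurable_continuous_onI borel_measurable_times)
    show "(\<lambda>x. diff_quot e f (h n) x * G n x) \<in> borel_measurable lborel" for n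
      using continuous_diff_quot[OF f] G(1)
      by (simp add: borel_measurable_continuous_onI borel_measurable_times)
    show "integrable lborel (\<lambda>x::'a. B * C * indicator (cball 0 (R + 1)) x)"
      by (intro integrable_mult_right integrable_real_indicator) (use emeasure_lborel_cball_finite[of 0 "R + 1"] in auto)
    show "AE x in lborel. (\<lambda>n. diff_quot e f (h n) x * G n x) \<longlonglongrightarrow> frechet_derivative f (at x) e * g x"
      by (intro AE_I2 tendsto_mult diff_quot_tendsto f h G)
    show "AE x in lborel. norm (diff_quot e f (h n) x * G n x) \<le> B * C * indicator (cball 0 (R + 1)) x" for n
    proof (rule AE_I2)
      fix x
      have "\<bar>diff_quot e f (h n) x\<bar> * \<bar>G n x\<bar> \<le> B * C"
        by (intro mult_mono diff_quot_bound f B h G) auto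
      then show "norm (diff_quot e f (h n) x * G n x) \<le> B * C * indicator (cball 0 (R + 1)) x"
        using diff_quot_support[of R f e "h n" x] R h(3) norm_Basis[OF e]
        by (cases "x \<in> cball 0 (R + 1)") (auto simp: abs_mult)
    qed
  qed
qed

lemma filterlim_inverse_Suc_at_0: 
  "filterlim (\<lambda>n. inverse (real (Suc n))) (at 0) sequentially"
  "filterlim (\<lambda>n. - inverse (real (Suc n))) (at 0) sequentially"
  using LIMSEQ_inverse_real_of_nat LIMSEQ_inverse_real_of_nat[THEN tendsto_minus]
  by (simp_all add: filterlim_at)

text \<open>Every difference quotient integrates to 0 by translation invariance, and the limit
  inherits this.\<close>

lemma integral_derivative_eq_0:
  assumes f: "compact_C1 f" and e: "e \<in> Basis"
  shows "(LINT x|lborel. frechet_derivative f (at x) e) = 0"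
proof -
  have "(\<lambda>n. LINT x|lborel. diff_quot e f (inverse (real (Suc n))) x * 1) \<longlonglongrightarrow>
    (LINT x|lborel. frechet_derivative f (at x) e * 1)"
    by (rule integral_diff_quot_tendsto[OF f e filterlim_inverse_Suc_at_0(1), where C = 1])
      (auto simp: inverse_le_1_iff intro!: continuous_intros)
  moreover have "(LINT x|lborel. diff_quot e f h x * 1) = 0" for h
  proof -
    have m: "f \<in> borel_measurable borel"
      using compact_C1_continuous[OF f] by (rule borel_measurable_continuous_onI)
    have i: "integrable lborel f"
      using f compact_C1_continuous[OF f] by (intro integrable_continuous_bounded_support) (auto simp: compact_C1_def)
    show ?thesis
      using i integrable_translation_lborel[OF i, of "h *\<^sub>R e"] integral_translation_lborel[OF m, of "h *\<^sub>R e"]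
      by (simp add: diff_quot_def)
  qed
  ultimately show ?thesis by (simp add: LIMSEQ_const_iff)
qed

text \<open>Translations preserve the integral and commute, so both differences can be moved to the other
  factor. In the limit this replaces two integrations by parts and needs no second derivatives.\<close>

lemma integral_diff_quot_swap:
  fixes f g :: "'a::euclidean_space \<Rightarrow> real"
  assumes f: "compact_C1 f" and g: "compact_C1 g"
  shows "(LINT x|lborel. diff_quot d f h x * diff_quot e g h x) =
    (LINT x|lborel. diff_quot e f (- h) x * diff_quot d g (- h) x)"
proof -
  define I where "I u v = (LINT x|lborel. f (x + u) * g (x + v))" for u v
  note cont = continuous_on_compose2[OF compact_C1_continuous[OF f]]
    continuous_on_compose2[OF compact_C1_continuous[OF g]]
  have int: "integrable lborel (\<lambda>x. f (x + u) * g (x + v))" for u v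
  proof -
    have "integrable lborel (\<lambda>x. f x * g (x + (v - u)))"
    proof (rule integrable_continuous_bounded_support)
      show "bounded {x. f x * g (x + (v - u)) \<noteq> 0}"
        using f unfolding compact_C1_def by (auto elim: bounded_subset)
    qed (intro continuous_intros cont, auto intro: compact_C1_continuous f)
    from integrable_translation_lborel[OF this, of u] show ?thesis by simp
  qed
  \<comment> \<open>Translation invariance: \<open>I u v\<close> depends only on the difference of
    its arguments.\<close>
  have shift: "I u v = I (u + z) (v + z)" for u v z
  proof -
    have "(\<lambda>x. f (x + u) * g (x + v)) \<in> borel_measurable borel"
      by (intro borel_measurable_continuous_onI continuous_intros cont) auto
    from integral_translation_lborel[OF this, of z] show ?thesis
      by (simp add: I_def add_ac)
  qed
  have expand: "(LINT x|lborel. diff_quot d f h x * diff_quot e g h x) =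
      (I (h *\<^sub>R d) (h *\<^sub>R e) - I (h *\<^sub>R d) 0 - I 0 (h *\<^sub>R e) + I 0 0) / h\<^sup>2" for d e h
  proof -
    have "(LINT x|lborel. diff_quot d f h x * diff_quot e g h x) =
      (LINT x|lborel. (f (x + h *\<^sub>R d) * g (x + h *\<^sub>R e) - f (x + h *\<^sub>R d) * g (x + 0)
        - f (x + 0) * g (x + h *\<^sub>R e) + f (x + 0) * g (x + 0)) / h\<^sup>2)"
      by (intro Bochner_Integration.integral_cong) (auto simp: diff_quot_def algebra_simps power2_eq_square add_divide_distrib diff_divide_distrib)
    also have "\<dots> = (I (h *\<^sub>R d) (h *\<^sub>R e) - I (h *\<^sub>R d) 0 - I 0 (h *\<^sub>R e) + I 0 0) / h\<^sup>2"
      unfolding I_def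
      by (simp only: Bochner_Integration.integral_add Bochner_Integration.integral_diff int
          Bochner_Integration.integrable_add Bochner_Integration.integrable_diff integral_divide_zero)
    finally show ?thesis .
  qed
  \<comment> \<open>The doubly shifted terms agree after a translation by h d + h e, and the two
    singly shifted terms trade places.\<close>
  show ?thesis
    unfolding expand
    using shift[of "- h *\<^sub>R e" "- h *\<^sub>R d" "h *\<^sub>R d + h *\<^sub>R e"]
      shift[of "- h *\<^sub>R e" 0 "h *\<^sub>R e"] shift[of 0 "- h *\<^sub>R d" "h *\<^sub>R d"]
    by simp
qed

text \<open>The identity behind Korn's inequality. One sequence of integrals, read with steps h, and
  again with steps -h and exchanged directions, has both sides as its limit.\<close>

lemma integral_derivatives_swap:
  fixes f g :: "'a::euclidean_space \<Rightarrow> real"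
  assumes f: "compact_C1 f" and g: "compact_C1 g" and d: "d \<in> Basis" and e: "e \<in> Basis"
  shows "(LINT x|lborel. frechet_derivative f (at x) d * frechet_derivative g (at x) e) =
    (LINT x|lborel. frechet_derivative f (at x) e * frechet_derivative g (at x) d)"
proof -
  have lim: "(\<lambda>n. LINT x|lborel. diff_quot d f (h n) x * diff_quot e g (h n) x) \<longlonglongrightarrow>
     (LINT x|lborel. frechet_derivative f (at x) d * frechet_derivative g (at x) e)"
    if d: "d \<in> Basis" and e: "e \<in> Basis"
      and h: "filterlim h (at 0) sequentially" "\<And>n. h n \<noteq> 0" "\<And>n. \<bar>h n\<bar> \<le> 1" for d e h
  proof -
    obtain B where B: "\<And>x. \<bar>frechet_derivative g (at x) e\<bar> \<le> B"
      using compact_C1_derivative_bound[OF g e] by blast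
    show ?thesis
      by (rule integral_diff_quot_tendsto[OF f d h, where C = B])
        (auto intro: continuous_diff_quot diff_quot_tendsto diff_quot_bound[OF g B h(2)]
          compact_C1_continuous_derivative g e h)
  qed
  have "(\<lambda>n. LINT x|lborel. diff_quot d f (inverse (real (Suc n))) x * diff_quot e g (inverse (real (Suc n))) x)
    \<longlonglongrightarrow> (LINT x|lborel. frechet_derivative f (at x) d * frechet_derivative g (at x) e)"
    by (rule lim[OF d e filterlim_inverse_Suc_at_0(1)]) (auto simp: inverse_le_1_iff)
  moreover have "(\<lambda>n. LINT x|lborel. diff_quot d f (inverse (real (Suc n))) x * diff_quot e g (inverse (real (Suc n))) x)
    \<longlonglongrightarrow> (LINT x|lborel. frechet_derivative f (at x) e * frechet_derivative g (at x) d)"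
    unfolding integral_diff_quot_swap[OF f g, of d _ e]
    by (rule lim[OF e d filterlim_inverse_Suc_at_0(2)]) (auto simp: inverse_le_1_iff)
  ultimately show ?thesis by (rule LIMSEQ_unique)
qed

section \<open>Square integrable functions\<close>

lemma L2_D:
  assumes "L2 A u"
  shows "u \<in> borel_measurable (lebesgue_on A)" "integrable (lebesgue_on A) (\<lambda>x. (norm (u x))\<^sup>2)"
  using assms by (auto simp: L2_def)

lemma L2_dominated:
  assumes "u \<in> borel_measurable (lebesgue_on A)" "integrable (lebesgue_on A) g"
    "AE x in lebesgue_on A. (norm (u x))\<^sup>2 \<le> g x"
  shows "L2 A u"
  unfolding L2_def
proof
  show "integrable (lebesgue_on A) (\<lambda>x. (norm (u x))\<^sup>2)"
    by (rule Bochner_Integration.integrable_bound[OF assms(2)])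
      (use assms in \<open>auto intro: eventually_mono\<close>)
qed (rule assms)

lemma L2_bounded_linear:
  assumes "bounded_linear T" "L2 A u"
  shows "L2 A (\<lambda>x. T (u x))"
proof -
  obtain K where K: "\<And>x. norm (T x) \<le> norm x * K" "K > 0"
    using bounded_linear.pos_bounded[OF assms(1)] by blast
  show ?thesis
  proof (rule L2_dominated)
    show "(\<lambda>x. T (u x)) \<in> borel_measurable (lebesgue_on A)"
      using L2_D(1)[OF assms(2)] linear_continuous_on[OF assms(1), of UNIV]
      by (auto intro: borel_measurable_continuous_onI measurable_compose)
    show "integrable (lebesgue_on A) (\<lambda>x. K\<^sup>2 * (norm (u x))\<^sup>2)"
      using L2_D(2)[OF assms(2)] by simp
    have "(norm (T (u x)))\<^sup>2 \<le> K\<^sup>2 * (norm (u x))\<^sup>2" for x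
      using power_mono[OF K(1)[of "u x"] norm_ge_zero, of 2] by (simp add: power_mult_distrib mult.commute)
    then show "AE x in lebesgue_on A. (norm (T (u x)))\<^sup>2 \<le> K\<^sup>2 * (norm (u x))\<^sup>2"
      by simp
  qed
qed

lemma norm_add_squared_le: "(norm (x + y))\<^sup>2 \<le> 2 * (norm x)\<^sup>2 + 2 * (norm (y::'a::real_inner))\<^sup>2"
proof -
  have "0 \<le> (norm (x - y))\<^sup>2" by simp
  then show ?thesis by (simp add: power2_norm_eq_inner inner_simps inner_commute)
qed

lemma L2_add:
  assumes "L2 A u" "L2 A v"
  shows "L2 A (\<lambda>x. u x + v x)"
  by (rule L2_dominated[where g = "\<lambda>x. 2 * (norm (u x))\<^sup>2 + 2 * (norm (v x))\<^sup>2"])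
    (use L2_D[OF assms(1)] L2_D[OF assms(2)] norm_add_squared_le in auto)

lemma L2_scaleR: "L2 A u \<Longrightarrow> L2 A (\<lambda>x. c *\<^sub>R u x)"
  by (rule L2_bounded_linear[OF bounded_linear_scaleR_right])

lemma L2_diff:
  assumes "L2 A u" "L2 A v"
  shows "L2 A (\<lambda>x. u x - v x)"
  using L2_add[OF assms(1) L2_scaleR[OF assms(2), of "-1"]] by simp

lemma L2_inner_integrable:
  assumes "L2 A u" "L2 A v"
  shows "integrable (lebesgue_on A) (\<lambda>x. u x \<bullet> v x)"
proof (rule Bochner_Integration.integrable_bound)
  show "integrable (lebesgue_on A) (\<lambda>x. (norm (u x))\<^sup>2 + (norm (v x))\<^sup>2)"
    using assms by (intro Bochner_Integration.integrable_add L2_D)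
  show "(\<lambda>x. u x \<bullet> v x) \<in> borel_measurable (lebesgue_on A)"
    using assms by (intro borel_measurable_inner L2_D)
  have "\<bar>a \<bullet> b\<bar> \<le> (norm a)\<^sup>2 + (norm b)\<^sup>2" for a b :: 'b
    using Cauchy_Schwarz_ineq2[of a b] sum_squares_bound[of "norm a" "norm b"]
      mult_nonneg_nonneg[OF norm_ge_zero[of a] norm_ge_zero[of b]] by linarith
  then show "AE x in lebesgue_on A. norm (u x \<bullet> v x) \<le> norm ((norm (u x))\<^sup>2 + (norm (v x))\<^sup>2)"
    by simp
qed

lemma L2_norm_nonneg: "0 \<le> L2_norm A u"
  by (simp add: L2_norm_def)

lemma L2_norm_squared: "(L2_norm A u)\<^sup>2 = (LINT x|lebesgue_on A. (norm (u x))\<^sup>2)"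
  by (simp add: L2_norm_def)

text \<open>Cauchy-Schwarz, from the nonnegativity of the quadratic t \<mapsto> ||u - t
  v||^2.\<close>

lemma L2_inner_le:
  assumes u: "L2 A u" and v: "L2 A v"
  shows "L2_inner A u v \<le> L2_norm A u * L2_norm A v"
proof -
  define U V s where "U = (L2_norm A u)\<^sup>2" and "V = (L2_norm A v)\<^sup>2" and "s = L2_inner A u v"
  have quad: "2 * t * s \<le> U + t\<^sup>2 * V" for t
  proof -
    have "0 \<le> (LINT x|lebesgue_on A. (norm (u x - t *\<^sub>R v x))\<^sup>2)" by simp
    also have "\<dots> = (LINT x|lebesgue_on A. (norm (u x))\<^sup>2 - 2 * t * (u x \<bullet> v x) + t\<^sup>2 * (norm (v x))\<^sup>2)"
      unfolding power2_norm_eq_inner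
      by (intro Bochner_Integration.integral_cong) (auto simp: inner_simps inner_commute power2_eq_square algebra_simps)
    also have "\<dots> = U - 2 * t * s + t\<^sup>2 * V"
      using L2_D[OF u] L2_D[OF v] L2_inner_integrable[OF u v]
      by (simp add: U_def V_def s_def L2_norm_squared L2_inner_def)
    finally show ?thesis by simp
  qed
  have "s\<^sup>2 \<le> U * V"
  proof (cases "V = 0")
    case True
    have "s = 0"
    proof (rule ccontr)
      assume "s \<noteq> 0"
      \<comment> \<open>With \<open>V = 0\<close> the bound is linear in t, and this choice of t
        turns it into U + 1 \<le> U.\<close>
      then show False using quad[of "(U + 1) / (2 * s)"] True by simp
    qed
    then show ?thesis using True by simp
  next
    case False
    then have "V > 0" by (simp add: V_def)
    \<comment> \<open>Here t is the minimiser of the quadratic.\<close>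
    then show ?thesis using quad[of "s / V"] by (simp add: field_simps power2_eq_square)
  qed
  then have "s\<^sup>2 \<le> (L2_norm A u * L2_norm A v)\<^sup>2"
    by (simp add: U_def V_def power_mult_distrib)
  then show ?thesis
    using power2_le_imp_le[of s "L2_norm A u * L2_norm A v"] by (simp add: s_def L2_norm_nonneg)
qed

lemma L2_norm_triangle:
  assumes u: "L2 A u" and v: "L2 A v"
  shows "L2_norm A (\<lambda>x. u x + v x) \<le> L2_norm A u + L2_norm A v"
proof (rule power2_le_imp_le)
  have "(L2_norm A (\<lambda>x. u x + v x))\<^sup>2 =
      (LINT x|lebesgue_on A. (norm (u x))\<^sup>2 + 2 * (u x \<bullet> v x) + (norm (v x))\<^sup>2)"
    unfolding L2_norm_squared power2_norm_eq_inner
    by (intro Bochner_Integration.integral_cong) (auto simp: inner_simps inner_commute)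
  also have "\<dots> = (L2_norm A u)\<^sup>2 + 2 * L2_inner A u v + (L2_norm A v)\<^sup>2"
    using L2_D[OF u] L2_D[OF v] L2_inner_integrable[OF u v]
    by (simp add: L2_norm_squared L2_inner_def)
  also have "\<dots> \<le> (L2_norm A u + L2_norm A v)\<^sup>2"
    using L2_inner_le[OF u v] by (simp add: power2_sum)
  finally show "(L2_norm A (\<lambda>x. u x + v x))\<^sup>2 \<le> (L2_norm A u + L2_norm A v)\<^sup>2" .
qed (simp add: L2_norm_nonneg)

lemma L2_norm_mono:
  assumes "L2 A u" "L2 A v" "AE x in lebesgue_on A. norm (u x) \<le> c * norm (v x)" "c \<ge> 0"
  shows "L2_norm A u \<le> c * L2_norm A v"
proof (rule power2_le_imp_le)
  have "(LINT x|lebesgue_on A. (norm (u x))\<^sup>2) \<le> (LINT x|lebesgue_on A. c\<^sup>2 * (norm (v x))\<^sup>2)"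
  proof (rule integral_mono_AE)
    show "AE x in lebesgue_on A. (norm (u x))\<^sup>2 \<le> c\<^sup>2 * (norm (v x))\<^sup>2"
      using assms(3) by eventually_elim (metis norm_ge_zero power_mono power_mult_distrib)
  qed (use L2_D[OF assms(1)] L2_D[OF assms(2)] in auto)
  then show "(L2_norm A u)\<^sup>2 \<le> (c * L2_norm A v)\<^sup>2"
    by (simp add: L2_norm_squared power_mult_distrib)
qed (simp add: assms L2_norm_nonneg)

lemma L2_norm_cong_AE:
  assumes "L2 A u" "L2 A v" "AE x in lebesgue_on A. u x = v x"
  shows "L2_norm A u = L2_norm A v"
proof (rule antisym)
  have "AE x in lebesgue_on A. norm (u x) \<le> 1 * norm (v x)"
    using assms(3) by eventually_elim simp
  then show "L2_norm A u \<le> L2_norm A v"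
    using L2_norm_mono[OF assms(1,2)] by fastforce
  have "AE x in lebesgue_on A. norm (v x) \<le> 1 * norm (u x)"
    using assms(3) by eventually_elim simp
  then show "L2_norm A v \<le> L2_norm A u"
    using L2_norm_mono[OF assms(2,1)] by fastforce
qed

lemma L2_norm_eq_0_imp_AE:
  assumes "L2 A u" "L2_norm A u = 0"
  shows "AE x in lebesgue_on A. u x = 0"
proof -
  have "(LINT x|lebesgue_on A. (norm (u x))\<^sup>2) = 0"
    using assms(2) L2_norm_squared[of A u] by simp
  then have "AE x in lebesgue_on A. (norm (u x))\<^sup>2 = 0"
    using integral_nonneg_eq_0_iff_AE[OF L2_D(2)[OF assms(1)]] by simp
  then show ?thesis by simp
qed

lemma L2_subset:
  assumes "L2 A u" "B \<subseteq> A" "A \<in> sets lebesgue" "B \<in> sets lebesgue"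
  shows "L2 B u" "L2_norm B u \<le> L2_norm A u"
proof -
  have int: "integrable (lebesgue_on B) (\<lambda>x. (norm (u x))\<^sup>2)"
  proof -
    have "integrable lebesgue (\<lambda>x. indicator A x *\<^sub>R (norm (u x))\<^sup>2)"
      using L2_D(2)[OF assms(1)] assms(3) by (simp add: integrable_restrict_space)
    from integrable_mult_indicator[OF assms(4) this]
    have "integrable lebesgue (\<lambda>x. indicator B x *\<^sub>R (norm (u x))\<^sup>2)"
      by (rule back_subst[of "integrable lebesgue"]) (use assms(2) in \<open>auto simp: indicator_def fun_eq_iff\<close>)
    then show ?thesis using assms(4) by (simp add: integrable_restrict_space)
  qed
  then show B: "L2 B u"
    using L2_D(1)[OF assms(1)] assms(2) measurable_restrict_mono by (auto simp: L2_def)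
  have "(LINT x|lebesgue_on B. (norm (u x))\<^sup>2) \<le> (LINT x|lebesgue_on A. (norm (u x))\<^sup>2)"
    by (rule integral_mono_lebesgue_on_AE) (use assms L2_D in auto)
  then show "L2_norm B u \<le> L2_norm A u"
    by (simp add: L2_norm_def)
qed

lemma L2_integrable:
  assumes "L2 A u" "A \<in> lmeasurable"
  shows "integrable (lebesgue_on A) u"
proof (rule Bochner_Integration.integrable_bound)
  interpret finite_measure "lebesgue_on A"
    using assms(2) by (rule finite_measure_lebesgue_on)
  show "integrable (lebesgue_on A) (\<lambda>x. 1 + (norm (u x))\<^sup>2)"
    using L2_D(2)[OF assms(1)] by simp
  have "norm a \<le> 1 + (norm a)\<^sup>2" for a :: 'b
  proof -
    have "norm a \<le> 2 * 1 * norm a" by simp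
    also have "\<dots> \<le> 1\<^sup>2 + (norm a)\<^sup>2" by (rule sum_squares_bound)
    finally show ?thesis by simp
  qed
  then show "AE x in lebesgue_on A. norm (u x) \<le> norm (1 + (norm (u x))\<^sup>2)"
    by simp
qed (rule L2_D[OF assms(1)])

lemma L2_continuous_bounded:
  assumes "continuous_on UNIV u" "\<And>x. norm (u x) \<le> B" "A \<in> lmeasurable"
  shows "L2 A u"
proof (rule L2_dominated)
  interpret finite_measure "lebesgue_on A"
    using assms(3) by (rule finite_measure_lebesgue_on)
  show "u \<in> borel_measurable (lebesgue_on A)"
    using assms(1) by (intro measurable_restrict_space1 measurable_completion) (simp add: borel_measurable_continuous_onI)
  show "integrable (lebesgue_on A) (\<lambda>x. B\<^sup>2)" by simp
  show "AE x in lebesgue_on A. (norm (u x))\<^sup>2 \<le> B\<^sup>2"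
    using assms(2) by (intro AE_I2 power_mono) auto
qed

lemma L2_sum:
  "finite I \<Longrightarrow> (\<And>i. i \<in> I \<Longrightarrow> L2 A (u i)) \<Longrightarrow> L2 A (\<lambda>x. \<Sum>i\<in>I. u i x)"
proof (induction I rule: finite_induct)
  case empty
  have "L2 A (\<lambda>x. 0)" by (auto simp: L2_def)
  then show ?case by simp
qed (auto intro: L2_add)

lemma bounded_linear_axis: "bounded_linear (axis i :: 'b::euclidean_space \<Rightarrow> 'b ^ 'n)"
  by (intro linear_conv_bounded_linear[THEN iffD1] linearI) (auto simp: axis_def vec_eq_iff)

lemma L2_componentwise:
  fixes u :: "'a::euclidean_space \<Rightarrow> 'b::euclidean_space ^ 'n"
  assumes "\<And>i. L2 A (\<lambda>x. u x $ i)"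
  shows "L2 A u"
proof -
  have "L2 A (\<lambda>x. \<Sum>i\<in>UNIV. axis i (u x $ i))"
    by (intro L2_sum L2_bounded_linear[OF bounded_linear_axis] assms) auto
  moreover have "(\<Sum>i\<in>UNIV. axis i (u x $ i)) = u x" for x
    by (simp add: vec_eq_iff axis_def)
  ultimately show ?thesis by simp
qed

lemma L2_component: 
  fixes u :: "'a::euclidean_space \<Rightarrow> 'b::euclidean_space ^ 'n"
  shows "L2 A u \<Longrightarrow> L2 A (\<lambda>x. u x $ i)"
  by (rule L2_bounded_linear[OF bounded_linear_vec_nth])

section \<open>Korn's and Poincare's inequalities\<close>

definition sym_part :: "real^'n^'n \<Rightarrow> real^'n^'n" where
  "sym_part A = (1 / 2) *\<^sub>R (A + transpose A)"

lemma matrix_inner: "A \<bullet> B = (\<Sum>i\<in>UNIV. \<Sum>j\<in>UNIV. A $ i $ j * B $ i $ j)" for A B :: "real^'n^'m"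
  by (simp add: inner_vec_def)

lemma inner_transpose_swap: "transpose A \<bullet> B = A \<bullet> transpose B" for A B :: "real^'n^'n"
  unfolding matrix_inner by (subst sum.swap) (simp add: transpose_def)

lemma norm_transpose: "norm (transpose A) = norm A" for A :: "real^'n^'n"
  by (simp add: norm_eq_sqrt_inner inner_transpose_swap transpose_transpose)

lemma transpose_sym_part: "transpose (sym_part A) = sym_part A"
  by (simp add: sym_part_def transpose_def vec_eq_iff add.commute)

text \<open>Common source of the two factors 2 below: wherever the product of A with its transpose
  is nonnegative, pointwise or after integration, the squared norm of A is at most twice that of its
  symmetric part. For an outer product p q^T that product is (p \<bullet> q)^2.\<close>

lemma norm_sym_part_squared: "(norm (sym_part A))\<^sup>2 = ((norm A)\<^sup>2 + A \<bullet> transpose A) / 2"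
  using inner_transpose_swap[of A A] inner_transpose_swap[of A "transpose A"]
  unfolding sym_part_def power2_norm_eq_inner
  by (simp add: inner_simps inner_commute transpose_transpose)

lemma norm_sym_part_le: "norm (sym_part A) \<le> norm A"
proof -
  have "norm (sym_part A) \<le> (1/2) * (norm A + norm (transpose A))"
    unfolding sym_part_def using norm_triangle_ineq[of A "transpose A"] by simp
  then show ?thesis by (simp add: norm_transpose)
qed

lemma bounded_linear_sym_part: "bounded_linear (sym_part :: real^'n^'n \<Rightarrow> _)"
  by (intro linear_conv_bounded_linear[THEN iffD1] linearI)
     (auto simp: sym_part_def transpose_def vec_eq_iff algebra_simps add_divide_distrib)

lemma sym_part_diff: "sym_part (A - B) = sym_part A - sym_part B"
  using bounded_linear_sym_part by (rule linear_diff[OF bounded_linear.linear])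

lemma norm_matrix_mult_axis_le: "norm (A *v axis j 1) \<le> norm A" for A :: "real^'n^'m"
proof (rule power2_le_imp_le)
  have "(norm (A *v axis j 1))\<^sup>2 = (\<Sum>i\<in>UNIV. (A $ i $ j)\<^sup>2)"
    unfolding power2_norm_eq_inner
    by (simp add: inner_vec_def matrix_vector_mult_basis column_def power2_eq_square)
  also have "\<dots> \<le> (\<Sum>i\<in>UNIV. \<Sum>j\<in>UNIV. (A $ i $ j)\<^sup>2)"
    by (intro sum_mono member_le_sum) auto
  also have "\<dots> = (norm A)\<^sup>2"
    unfolding power2_norm_eq_inner by (simp add: matrix_inner power2_eq_square)
  finally show "(norm (A *v axis j 1))\<^sup>2 \<le> (norm A)\<^sup>2" .
qed simp

section \<open>Korn and Poincare for test fields\<close>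

definition test_field :: "(real^3) set \<Rightarrow> (real^3 \<Rightarrow> real^3) \<Rightarrow> bool" where
  "test_field A \<phi> \<longleftrightarrow> (\<forall>i. test_fun A (\<lambda>x. \<phi> x $ i))"

lemma test_field_compact_C1: "test_field A \<phi> \<Longrightarrow> compact_C1 (\<lambda>x. \<phi> x $ i)"
  by (auto simp: test_field_def intro: test_fun_imp_compact_C1)

lemma jacobian_component:
  assumes "test_field A \<phi>"
  shows "jacobian \<phi> (at x) $ i $ j = frechet_derivative (\<lambda>x. \<phi> x $ i) (at x) (axis j 1)"
proof -
  have "\<phi> differentiable (at x)"
  proof (subst differentiable_componentwise_within, intro ballI)
    fix e :: "real^3" assume "e \<in> Basis"
    then obtain i where "e = axis i 1" by (auto simp: Basis_vec_def)
    then show "(\<lambda>x. \<phi> x \<bullet> e) differentiable (at x)"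
      using compact_C1_differentiable[OF test_field_compact_C1[OF assms]] by (simp add: inner_axis)
  qed
  then have "(\<phi> has_derivative frechet_derivative \<phi> (at x)) (at x)"
    by (simp add: frechet_derivative_works[symmetric])
  then have "((\<lambda>x. \<phi> x $ i) has_derivative (\<lambda>e. frechet_derivative \<phi> (at x) e $ i)) (at x)"
    by (rule bounded_linear.has_derivative[OF bounded_linear_vec_nth])
  from frechet_derivative_apply[OF this] show ?thesis
    by (simp add: jacobian_def matrix_def)
qed

lemma integral_lebesgue_on_eq_lborel:
  fixes f :: "'a::euclidean_space \<Rightarrow> real"
  assumes "f \<in> borel_measurable borel" "\<And>x. x \<notin> A \<Longrightarrow> f x = 0" "A \<in> sets lebesgue"
  shows "(LINT x|lebesgue_on A. f x) = (LINT x|lborel. f x)"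
proof -
  have "(LINT x|lebesgue_on A. f x) = (LINT x|lebesgue. indicator A x *\<^sub>R f x)"
    using assms(3) by (simp add: integral_restrict_space)
  also have "\<dots> = (LINT x|lebesgue. f x)"
    using assms(2) by (intro Bochner_Integration.integral_cong) (auto simp: indicator_def)
  also have "\<dots> = (LINT x|lborel. f x)"
    using assms(1) by (simp add: integral_completion)
  finally show ?thesis .
qed

lemma test_fun_zero_outside:
  assumes "test_fun A \<phi>" "x \<notin> A"
  shows "\<phi> x = 0" "frechet_derivative \<phi> (at x) e = 0"
proof -
  have x: "x \<notin> closure {x. \<phi> x \<noteq> 0}" using assms by (auto simp: test_fun_def)
  then show "\<phi> x = 0" using closure_subset[of "{x. \<phi> x \<noteq> 0}"] by auto
  from x show "frechet_derivative \<phi> (at x) e = 0" by (rule frechet_derivative_eq_0_outside_support)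
qed

lemma axis_in_Basis_real: "axis i (1::real) \<in> Basis"
  by (simp add: axis_in_Basis_iff)

lemma L2_compact_C1:
  assumes "compact_C1 f" "A \<in> lmeasurable"
  shows "L2 A f" "e \<in> Basis \<Longrightarrow> L2 A (\<lambda>x. frechet_derivative f (at x) e)"
proof -
  let ?K = "closure {x. f x \<noteq> 0}"
  have "compact ?K" using assms(1) by (simp add: compact_C1_def)
  then have "bounded (f ` ?K)"
    using compact_C1_continuous[OF assms(1)] 
    by (intro compact_imp_bounded compact_continuous_image) (auto elim: continuous_on_subset)
  then obtain B where B: "\<And>x. x \<in> ?K \<Longrightarrow> \<bar>f x\<bar> \<le> B"
    unfolding bounded_iff by (metis imageI real_norm_def)
  have "norm (f x) \<le> \<bar>B\<bar>" for x
    using B[of x] closure_subset[of "{x. f x \<noteq> 0}"] by (cases "f x = 0") auto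
  then show "L2 A f"
    using L2_continuous_bounded compact_C1_continuous[OF assms(1)] assms(2) by blast
  assume e: "e \<in> Basis"
  show "L2 A (\<lambda>x. frechet_derivative f (at x) e)"
    using compact_C1_derivative_bound[OF assms(1) e] L2_continuous_bounded[OF compact_C1_continuous_derivative[OF assms(1) e] _ assms(2)]
    by (metis real_norm_def)
qed

lemma test_field_L2:
  assumes "test_field A \<phi>" "B \<in> lmeasurable"
  shows "L2 B \<phi>" "L2 B (\<lambda>x. jacobian \<phi> (at x))"
  using L2_compact_C1[OF test_field_compact_C1[OF assms(1)] assms(2)]
  by (auto intro!: L2_componentwise simp: jacobian_component[OF assms(1)] axis_in_Basis_real)

text \<open>Exchanging derivatives turns the integral of D_j \<phi>_i D_i \<phi>_j into that of D_i
  \<phi>_i D_j \<phi>_j. Summed over i and j, the product of the Jacobian with its transpose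
  integrates to the square of the divergence, which is nonnegative.\<close>

lemma korn_test_field:
  assumes A: "A \<in> lmeasurable" and \<phi>: "test_field A \<phi>"
  shows "L2_norm A (\<lambda>x. jacobian \<phi> (at x)) \<le> sqrt 2 * L2_norm A (\<lambda>x. sym_part (jacobian \<phi> (at x)))"
proof (rule power2_le_imp_le)
  define D where "D i j x = frechet_derivative (\<lambda>x. \<phi> x $ i) (at x) (axis j 1)" for i j x
  let ?J = "\<lambda>x. jacobian \<phi> (at x)"
  have J: "?J x $ i $ j = D i j x" for i j x
    by (simp add: jacobian_component[OF \<phi>] D_def)
  have L2D: "L2 A (D i j)" for i j
    unfolding D_def by (intro L2_compact_C1 test_field_compact_C1[OF \<phi>] A axis_in_Basis_real)
  have intD: "integrable (lebesgue_on A) (\<lambda>x. D i j x * D k l x)" for i j k l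
    using L2_inner_integrable[OF L2D L2D] by simp
  have swap: "(LINT x|lebesgue_on A. D i j x * D j i x) = (LINT x|lebesgue_on A. D i i x * D j j x)" for i j
  proof -
    have meas: "D i j \<in> borel_measurable borel" for i j
      unfolding D_def
      by (intro borel_measurable_continuous_onI compact_C1_continuous_derivative test_field_compact_C1[OF \<phi>] axis_in_Basis_real)
    have zero: "x \<notin> A \<Longrightarrow> D i j x = 0" for i j x
      using \<phi> by (auto simp: D_def test_field_def intro: test_fun_zero_outside)
    \<comment> \<open>All derivatives vanish off A, so integrals over A are integrals over the whole
      space, where translations are available.\<close>
    have conv: "(LINT x|lebesgue_on A. D i j x * D k l x) = (LINT x|lborel. D i j x * D k l x)" for i j k l
      using A by (intro integral_lebesgue_on_eq_lborel borel_measurable_times meas) (auto simp: zero)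
    show ?thesis
      unfolding conv unfolding D_def
      by (intro integral_derivatives_swap test_field_compact_C1[OF \<phi>] axis_in_Basis_real)
  qed
  have "(LINT x|lebesgue_on A. ?J x \<bullet> transpose (?J x)) = 
      (\<Sum>i\<in>UNIV. \<Sum>j\<in>UNIV. (LINT x|lebesgue_on A. D i j x * D j i x))"
    unfolding matrix_inner by (simp add: J transpose_def intD)
  also have "\<dots> = (\<Sum>i\<in>UNIV. \<Sum>j\<in>UNIV. (LINT x|lebesgue_on A. D i i x * D j j x))"
    by (simp add: swap)
  also have "\<dots> = (LINT x|lebesgue_on A. (\<Sum>i\<in>UNIV. \<Sum>j\<in>UNIV. D i i x * D j j x))"
    by (simp add: intD)
  also have "\<dots> = (LINT x|lebesgue_on A. (\<Sum>i\<in>UNIV. D i i x)\<^sup>2)"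
    by (simp add: power2_eq_square sum_product)
  finally have pos: "(LINT x|lebesgue_on A. ?J x \<bullet> transpose (?J x)) \<ge> 0" by simp
  have intJ: "integrable (lebesgue_on A) (\<lambda>x. ?J x \<bullet> transpose (?J x))"
    unfolding matrix_inner by (simp add: J transpose_def intD)
  have "(L2_norm A (\<lambda>x. sym_part (?J x)))\<^sup>2 =
      (LINT x|lebesgue_on A. ((norm (?J x))\<^sup>2 + ?J x \<bullet> transpose (?J x)) / 2)"
    by (simp add: L2_norm_squared norm_sym_part_squared)
  also have "\<dots> = ((L2_norm A ?J)\<^sup>2 + (LINT x|lebesgue_on A. ?J x \<bullet> transpose (?J x))) / 2"
    using intJ L2_D(2)[OF test_field_L2(2)[OF \<phi> A]] by (simp add: L2_norm_squared)
  finally show "(L2_norm A ?J)\<^sup>2 \<le> (sqrt 2 * L2_norm A (\<lambda>x. sym_part (?J x)))\<^sup>2"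
    using pos by (simp add: power_mult_distrib)
qed (simp add: L2_norm_nonneg)

lemma times_diff_component: "times_diff k (\<lambda>x::real^'n. x $ i)"
proof (cases k)
  case (Suc m)
  have d: "((\<lambda>x::real^'n. x $ i) has_derivative (\<lambda>e. e $ i)) (at x)" for x
    by (rule bounded_linear_imp_has_derivative[OF bounded_linear_vec_nth])
  then have "(\<lambda>x::real^'n. x $ i) differentiable (at x)" for x
    unfolding differentiable_def by blast
  then show ?thesis
    using Suc by (simp add: frechet_derivative_apply[OF d] times_diff_const)
qed (auto intro!: continuous_intros)

text \<open>The derivative of x_1 \<phi>_i^2 in direction 1 integrates to 0, so the integral of
  \<phi>_i^2 equals that of -2 x_1 \<phi>_i D_1 \<phi>_i. Cauchy-Schwarz with |x_1| \<le> R then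
  leaves one factor ||\<phi>|| to cancel. The fields \<open>u\<close> and \<open>v\<close> are the
  two factors of this product.\<close>

lemma poincare_test_field:
  assumes A: "A \<in> lmeasurable" "\<And>x. x \<in> A \<Longrightarrow> norm x \<le> R" "R \<ge> 0" and \<phi>: "test_field A \<phi>"
  shows "L2_norm A \<phi> \<le> 2 * R * L2_norm A (\<lambda>x. jacobian \<phi> (at x))"
proof -
  let ?J = "\<lambda>x. jacobian \<phi> (at x)"
  let ?e = "axis 1 1 :: real^3"
  define v where "v x = ?J x *v ?e" for x
  define u where "u x = (- 2 * (x $ 1)) *\<^sub>R \<phi> x" for x
  have v: "v x $ i = frechet_derivative (\<lambda>x. \<phi> x $ i) (at x) ?e" for x i
    by (simp add: v_def matrix_vector_mult_basis column_def jacobian_component[OF \<phi>])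
  have C1: "compact_C1 (\<lambda>x. \<phi> x $ i)" for i by (rule test_field_compact_C1[OF \<phi>])
  have L2\<phi>: "L2 A \<phi>" and L2J: "L2 A ?J" using test_field_L2[OF \<phi> A(1)] by auto
  have L2v: "L2 A v"
    unfolding v_def by (intro L2_bounded_linear[OF _ L2J] linear_conv_bounded_linear[THEN iffD1])
      (auto intro!: linearI simp: matrix_vector_mult_add_rdistrib scaleR_matrix_vector_assoc)
  have u_le: "norm (u x) \<le> 2 * R * norm (\<phi> x)" for x
  proof (cases "x \<in> A")
    case True
    then have "\<bar>x $ 1\<bar> \<le> R" using A(2) component_le_norm_cart order_trans by blast
    then show ?thesis by (simp add: u_def abs_mult mult_right_mono)
  next
    case False
    then have "\<phi> x = 0" using \<phi> by (auto simp: vec_eq_iff test_field_def intro: test_fun_zero_outside)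
    then show ?thesis by (simp add: u_def)
  qed
  have L2u: "L2 A u"
  proof (rule L2_dominated)
    have "continuous_on UNIV (\<lambda>x. \<phi> x $ i)" for i using compact_C1_continuous[OF C1] .
    then have "continuous_on UNIV u"
      unfolding u_def by (intro continuous_intros) (simp add: continuous_on_vec_lambda[of UNIV "\<lambda>i x. \<phi> x $ i", simplified])
    then show "u \<in> borel_measurable (lebesgue_on A)"
      by (intro measurable_restrict_space1 measurable_completion) (simp add: borel_measurable_continuous_onI)
    show "integrable (lebesgue_on A) (\<lambda>x. (2 * R)\<^sup>2 * (norm (\<phi> x))\<^sup>2)"
      using L2_D(2)[OF L2\<phi>] by simp
    show "AE x in lebesgue_on A. (norm (u x))\<^sup>2 \<le> (2 * R)\<^sup>2 * (norm (\<phi> x))\<^sup>2"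
      using power_mono[OF u_le norm_ge_zero, of _ 2] by (simp add: power_mult_distrib)
  qed
  have comp: "(LINT x|lebesgue_on A. \<phi> x $ i * \<phi> x $ i) = (LINT x|lebesgue_on A. u x $ i * v x $ i)" for i
  proof -
    let ?F = "\<lambda>x. x $ 1 * (\<phi> x $ i * \<phi> x $ i)"
    have F: "compact_C1 ?F"
      by (rule compact_C1_mult[OF times_diff_component compact_C1_mult[OF _ C1]]) (use C1 in \<open>simp add: compact_C1_def\<close>)
    have dF: "frechet_derivative ?F (at x) ?e = \<phi> x $ i * \<phi> x $ i - u x $ i * v x $ i" for x
    proof -
      have "((\<lambda>x::real^3. x $ 1) has_derivative (\<lambda>e. e $ 1)) (at x)"
        by (rule bounded_linear_imp_has_derivative[OF bounded_linear_vec_nth])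
      note deriv = has_derivative_mult[OF this has_derivative_mult[OF
            compact_C1_has_derivative[OF C1[of i]] compact_C1_has_derivative[OF C1[of i]]]]
      show ?thesis
        by (simp add: frechet_derivative_apply[OF deriv] v u_def axis_def algebra_simps)
    qed
    have "(LINT x|lebesgue_on A. frechet_derivative ?F (at x) ?e) = (LINT x|lborel. frechet_derivative ?F (at x) ?e)"
    proof (rule integral_lebesgue_on_eq_lborel)
      show "(\<lambda>x. frechet_derivative ?F (at x) ?e) \<in> borel_measurable borel"
        by (intro borel_measurable_continuous_onI compact_C1_continuous_derivative F axis_in_Basis_real)
      show "frechet_derivative ?F (at x) ?e = 0" if "x \<notin> A" for x
      proof -
        have "\<phi> x $ i = 0"
          using \<phi> that by (auto simp: test_field_def intro: test_fun_zero_outside)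
        then show ?thesis unfolding dF by (simp add: u_def)
      qed
    qed (use A in auto)
    then have "(LINT x|lebesgue_on A. \<phi> x $ i * \<phi> x $ i - u x $ i * v x $ i) = 0"
      by (simp only: integral_derivative_eq_0[OF F axis_in_Basis_real]) (simp only: dF)
    then show ?thesis
      using L2_inner_integrable[OF L2_component[OF L2\<phi>] L2_component[OF L2\<phi>], of i i]
        L2_inner_integrable[OF L2_component[OF L2u] L2_component[OF L2v], of i i] by simp
  qed
  have "(L2_norm A \<phi>)\<^sup>2 = (\<Sum>i\<in>UNIV. LINT x|lebesgue_on A. \<phi> x $ i * \<phi> x $ i)"
    using L2_inner_integrable[OF L2_component[OF L2\<phi>] L2_component[OF L2\<phi>]]
    by (simp add: L2_norm_squared power2_norm_eq_inner inner_vec_def)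
  also have "\<dots> = L2_inner A u v"
    using L2_inner_integrable[OF L2_component[OF L2u] L2_component[OF L2v]]
    by (simp add: comp L2_inner_def inner_vec_def)
  also have "\<dots> \<le> L2_norm A u * L2_norm A v" by (rule L2_inner_le[OF L2u L2v])
  also have "\<dots> \<le> (2 * R * L2_norm A \<phi>) * L2_norm A ?J"
  proof (intro mult_mono)
    show "L2_norm A u \<le> 2 * R * L2_norm A \<phi>"
      using A(3) u_le by (intro L2_norm_mono L2u L2\<phi>) auto
    show "L2_norm A v \<le> L2_norm A ?J"
      using L2_norm_mono[OF L2v L2J, of 1] by (simp add: v_def norm_matrix_mult_axis_le)
  qed (use A in \<open>auto simp: L2_norm_nonneg\<close>)
  finally have *: "L2_norm A \<phi> * L2_norm A \<phi> \<le> L2_norm A \<phi> * (2 * R * L2_norm A ?J)"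
    by (simp add: power2_eq_square mult_ac)
  show ?thesis
  proof (cases "L2_norm A \<phi> = 0")
    case False
    then have "L2_norm A \<phi> > 0" using L2_norm_nonneg[of A \<phi>] by simp
    with * show ?thesis by (simp add: mult_le_cancel_left_pos)
  qed (use A(3) L2_norm_nonneg[of A ?J] in auto)
qed

section \<open>Weak gradients and passage to the closure\<close>

lemma H1_wgrad:
  assumes "u \<in> H1 A"
  shows "L2 A u" "L2 A (wgrad A u)" "is_weak_grad A u (wgrad A u)"
proof -
  have "\<exists>G. L2 A G \<and> is_weak_grad A u G" using assms by (simp add: H1_def)
  then have "L2 A (wgrad A u) \<and> is_weak_grad A u (wgrad A u)"
    unfolding wgrad_def by (rule someI_ex)
  then show "L2 A (wgrad A u)" "is_weak_grad A u (wgrad A u)" by auto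
  show "L2 A u" using assms by (simp add: H1_def)
qed

text \<open>\<open>wgrad\<close> is a choice, so this is what relates gradients taken on different
  domains. Each entry of the difference integrates to 0 against test functions; the finite measure
  of A makes it integrable.\<close>

lemma weak_grad_unique:
  assumes A: "open A" "A \<in> lmeasurable"
    and G: "L2 A G" "is_weak_grad A u G" and G': "L2 A G'" "is_weak_grad A u G'"
  shows "AE x in lebesgue_on A. G x = G' x"
proof -
  have "AE x in lebesgue_on A. G x $ i $ j - G' x $ i $ j = 0" for i j
  proof (rule fundamental_lemma_calculus_of_variations[OF A(1)])
    note comp = L2_component[OF L2_component[OF G(1)], of i j] L2_component[OF L2_component[OF G'(1)], of i j]
    show "integrable (lebesgue_on A) (\<lambda>x. G x $ i $ j - G' x $ i $ j)"
      by (rule L2_integrable[OF L2_diff[OF comp] A(2)])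
    fix \<phi> assume \<phi>: "test_fun A \<phi>"
    have L2\<phi>: "L2 A \<phi>" by (rule L2_compact_C1[OF test_fun_imp_compact_C1[OF \<phi>] A(2)])
    have "(LINT x|lebesgue_on A. G x $ i $ j * \<phi> x) = (LINT x|lebesgue_on A. G' x $ i $ j * \<phi> x)"
      using G(2)[unfolded is_weak_grad_def, rule_format, OF \<phi>, of i j]
        G'(2)[unfolded is_weak_grad_def, rule_format, OF \<phi>, of i j] by simp
    then show "(LINT x|lebesgue_on A. (G x $ i $ j - G' x $ i $ j) * \<phi> x) = 0"
      using L2_inner_integrable[OF comp(1) L2\<phi>] L2_inner_integrable[OF comp(2) L2\<phi>]
      by (simp add: left_diff_distrib)
  qed
  then have "AE x in lebesgue_on A. \<forall>i j. G x $ i $ j - G' x $ i $ j = 0"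
    by (simp add: AE_all_countable)
  then show ?thesis by eventually_elim (simp add: vec_eq_iff)
qed

lemma is_weak_grad_subset:
  assumes "is_weak_grad A u G" "B \<subseteq> A" "A \<in> sets lebesgue" "B \<in> sets lebesgue"
  shows "is_weak_grad B u G"
  unfolding is_weak_grad_def
proof (intro allI impI)
  fix \<phi> i j assume \<phi>: "test_fun B \<phi>"
  then have "test_fun A \<phi>" using assms(2) by (auto simp: test_fun_def)
  have eq: "(LINT x|lebesgue_on A. f x) = (LINT x|lebesgue_on B. f x)" if "\<And>x. x \<notin> B \<Longrightarrow> f x = 0" for f :: "real^3 \<Rightarrow> real"
  proof -
    have "(LINT x|lebesgue. indicator A x *\<^sub>R f x) = (LINT x|lebesgue. indicator B x *\<^sub>R f x)"
      using that assms(2) by (intro Bochner_Integration.integral_cong) (auto simp: indicator_def)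
    then show ?thesis using assms(3,4) by (simp add: integral_restrict_space)
  qed
  have "(LINT x|lebesgue_on A. u x $ i * frechet_derivative \<phi> (at x) (axis j 1)) =
     (LINT x|lebesgue_on B. u x $ i * frechet_derivative \<phi> (at x) (axis j 1))"
    "(LINT x|lebesgue_on A. G x $ i $ j * \<phi> x) = (LINT x|lebesgue_on B. G x $ i $ j * \<phi> x)"
    by (rule eq, simp add: test_fun_zero_outside[OF \<phi>])+
  then show "(LINT x|lebesgue_on B. u x $ i * frechet_derivative \<phi> (at x) (axis j 1)) =
     - (LINT x|lebesgue_on B. G x $ i $ j * \<phi> x)"
    using assms(1)[unfolded is_weak_grad_def, rule_format, OF \<open>test_fun A \<phi>\<close>, of i j] by simp
qed

text \<open>The norm on B uses the gradient chosen on B. By uniqueness it agrees almost everywhere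
  with the restriction of the one chosen on A, and passing to a subset only shrinks the
  norms.\<close>

lemma H1_subset:
  assumes u: "u \<in> H1 A" and "B \<subseteq> A" "open A" "open B" "bounded A"
  shows "u \<in> H1 B" "H1_norm B u \<le> H1_norm A u"
proof -
  have m: "A \<in> lmeasurable" "B \<in> lmeasurable"
    using assms bounded_subset by (auto intro: lmeasurable_open)
  then have s: "A \<in> sets lebesgue" "B \<in> sets lebesgue" by auto
  note G = H1_wgrad[OF u]
  have L2: "L2 B u" "L2 B (wgrad A u)" and wg: "is_weak_grad B u (wgrad A u)"
    using L2_subset(1)[OF G(1) assms(2) s] L2_subset(1)[OF G(2) assms(2) s]
      is_weak_grad_subset[OF G(3) assms(2) s] by auto
  then show B: "u \<in> H1 B" by (auto simp: H1_def)
  have "AE x in lebesgue_on B. wgrad B u x = wgrad A u x"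
    by (rule weak_grad_unique[OF assms(4) m(2) H1_wgrad(2,3)[OF B] L2(2) wg])
  then have "L2_norm B (wgrad B u) = L2_norm B (wgrad A u)"
    by (rule L2_norm_cong_AE[OF H1_wgrad(2)[OF B] L2(2)])
  then show "H1_norm B u \<le> H1_norm A u"
    using L2_subset(2)[OF G(1) assms(2) s] L2_subset(2)[OF G(2) assms(2) s]
    by (simp add: H1_norm_def)
qed

lemma L2_norm_minus_commute: "L2_norm A (\<lambda>x. u x - v x) = L2_norm A (\<lambda>x. v x - u x)"
  by (simp add: L2_norm_def norm_minus_commute)

text \<open>Both inequalities are continuous in the norms of u and of its gradient, the two in which
  \<open>H1_zero\<close> approximates by test fields. Taking symmetric parts does not increase
  norms, so the symmetrised error is again at most \<open>b k\<close>.\<close>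

lemma H1_zero_korn_poincare:
  assumes u: "u \<in> H1_zero A" and A: "A \<in> lmeasurable" "\<And>x. x \<in> A \<Longrightarrow> norm x \<le> R" "R \<ge> 0"
  shows "L2_norm A (wgrad A u) \<le> sqrt 2 * L2_norm A (\<lambda>x. sym_part (wgrad A u x))"
    and "L2_norm A u \<le> 2 * R * L2_norm A (wgrad A u)"
proof -
  let ?G = "wgrad A u"
  have H1: "u \<in> H1 A" using u by (simp add: H1_zero_def)
  note G = H1_wgrad(1,2)[OF H1]
  obtain \<phi> where \<phi>: "\<And>k. test_field A (\<phi> k)"
    and lim: "(\<lambda>k. L2_norm A (\<lambda>x. u x - \<phi> k x)) \<longlonglongrightarrow> 0"
      "(\<lambda>k. L2_norm A (\<lambda>x. ?G x - jacobian (\<phi> k) (at x))) \<longlonglongrightarrow> 0"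
    using u by (auto simp: H1_zero_def test_field_def)
  define J where "J k x = jacobian (\<phi> k) (at x)" for k x
  define a where "a k = L2_norm A (\<lambda>x. u x - \<phi> k x)" for k
  define b where "b k = L2_norm A (\<lambda>x. ?G x - J k x)" for k
  have ab: "a \<longlonglongrightarrow> 0" "b \<longlonglongrightarrow> 0" using lim by (simp_all add: a_def[abs_def] b_def[abs_def] J_def)
  have L2\<phi>: "L2 A (\<phi> k)" and L2J: "L2 A (J k)" for k
    using test_field_L2[OF \<phi> A(1)] by (auto simp: J_def[abs_def])
  have sym: "L2 A (\<lambda>x. sym_part (v x))" if "L2 A v" for v :: "real^3 \<Rightarrow> real^3^3"
    by (rule L2_bounded_linear[OF bounded_linear_sym_part that])
  have G_le: "L2_norm A ?G \<le> L2_norm A (J k) + b k" for k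
    using L2_norm_triangle[OF L2J[of k] L2_diff[OF G(2) L2J[of k]]] by (simp add: b_def)
  have J_le: "L2_norm A (J k) \<le> L2_norm A ?G + b k" for k
    using L2_norm_triangle[OF G(2) L2_diff[OF L2J[of k] G(2)]] L2_norm_minus_commute[of A ?G "J k"] by (simp add: b_def)
  have "L2_norm A ?G \<le> sqrt 2 * (L2_norm A (\<lambda>x. sym_part (?G x)) + b k) + b k" for k
  proof -
    have "L2_norm A (\<lambda>x. sym_part (J k x)) \<le>
        L2_norm A (\<lambda>x. sym_part (?G x)) + L2_norm A (\<lambda>x. sym_part (J k x - ?G x))"
      using L2_norm_triangle[OF sym[OF G(2)] sym[OF L2_diff[OF L2J[of k] G(2)]]] by (simp add: sym_part_diff)
    also have "L2_norm A (\<lambda>x. sym_part (J k x - ?G x)) \<le> 1 * L2_norm A (\<lambda>x. J k x - ?G x)"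
      by (intro L2_norm_mono sym L2_diff L2J G) (auto simp: norm_sym_part_le)
    also have "\<dots> = b k" by (simp add: b_def L2_norm_minus_commute[of A ?G "J k"])
    finally have "sqrt 2 * L2_norm A (\<lambda>x. sym_part (J k x)) \<le> sqrt 2 * (L2_norm A (\<lambda>x. sym_part (?G x)) + b k)"
      by simp
    then show ?thesis
      using G_le[of k] korn_test_field[OF A(1) \<phi>[of k]] unfolding J_def[symmetric] by linarith
  qed
  moreover have "(\<lambda>k. sqrt 2 * (L2_norm A (\<lambda>x. sym_part (?G x)) + b k) + b k)
     \<longlonglongrightarrow> sqrt 2 * (L2_norm A (\<lambda>x. sym_part (?G x)) + 0) + 0"
    by (intro tendsto_intros ab)
  ultimately show "L2_norm A ?G \<le> sqrt 2 * L2_norm A (\<lambda>x. sym_part (?G x))"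
    using LIMSEQ_le_const by fastforce
  have "L2_norm A u \<le> 2 * R * (L2_norm A ?G + b k) + a k" for k
  proof -
    have "L2_norm A u \<le> L2_norm A (\<phi> k) + a k"
      using L2_norm_triangle[OF L2\<phi>[of k] L2_diff[OF G(1) L2\<phi>[of k]]] by (simp add: a_def)
    moreover have "L2_norm A (\<phi> k) \<le> 2 * R * L2_norm A (J k)"
      using poincare_test_field[OF A \<phi>[of k]] by (simp add: J_def[abs_def])
    moreover have "2 * R * L2_norm A (J k) \<le> 2 * R * (L2_norm A ?G + b k)"
      using J_le[of k] A(3) by (intro mult_left_mono) auto
    ultimately show ?thesis by linarith
  qed
  moreover have "(\<lambda>k. 2 * R * (L2_norm A ?G + b k) + a k) \<longlonglongrightarrow> 2 * R * (L2_norm A ?G + 0) + 0"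
    by (intro tendsto_intros ab)
  ultimately show "L2_norm A u \<le> 2 * R * L2_norm A ?G"
    using LIMSEQ_le_const by fastforce
qed

section \<open>Elasticity tensors\<close>

lemma elasticity_tensorD:
  assumes "elasticity_tensor T"
  shows "T $ i $ j $ k $ l = T $ j $ i $ k $ l" "T $ i $ j $ k $ l = T $ i $ j $ l $ k"
  using assms unfolding elasticity_tensor_def by blast+

lemma elasticity_tensor_diff:
  "elasticity_tensor S \<Longrightarrow> elasticity_tensor T \<Longrightarrow> elasticity_tensor (S - T)"
  by (simp add: elasticity_tensor_def)

lemma linear_tensor_apply: "linear (tensor_apply T)"
  by (rule linearI)
    (auto simp: tensor_apply_def vec_eq_iff algebra_simps sum.distrib sum_distrib_left)

lemma bounded_linear_tensor_apply: "bounded_linear (tensor_apply T)"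
  using linear_tensor_apply linear_conv_bounded_linear by blast

lemma tensor_apply_transpose:
  assumes "elasticity_tensor T"
  shows "tensor_apply T (transpose A) = tensor_apply T A" "transpose (tensor_apply T A) = tensor_apply T A"
proof -
  have "(\<Sum>k\<in>UNIV. \<Sum>l\<in>UNIV. T $ i $ j $ k $ l * A $ l $ k) = (\<Sum>k\<in>UNIV. \<Sum>l\<in>UNIV. T $ i $ j $ k $ l * A $ k $ l)" for i j
    by (subst sum.swap) (simp add: elasticity_tensorD(2)[OF assms, of i j])
  then show "tensor_apply T (transpose A) = tensor_apply T A"
    by (simp add: tensor_apply_def transpose_def)
  show "transpose (tensor_apply T A) = tensor_apply T A"
    by (simp add: tensor_apply_def transpose_def vec_eq_iff elasticity_tensorD(1)[OF assms, symmetric])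
qed

lemma tensor_apply_sym_part:
  assumes "elasticity_tensor T"
  shows "tensor_apply T (sym_part A) = tensor_apply T A"
  using tensor_apply_transpose(1)[OF assms, of A]
  by (simp add: sym_part_def linear_cmul[OF linear_tensor_apply] linear_add[OF linear_tensor_apply] scaleR_2[symmetric])

text \<open>Ellipticity is assumed on symmetric matrices only. The minor symmetries make T ignore
  the skew part of its argument and take symmetric values, so A has the same energy as its symmetric
  part.\<close>

lemma strongly_elliptic_sym_part:
  assumes T: "elasticity_tensor T" and "strongly_elliptic c T"
  shows "c * (norm (sym_part A))\<^sup>2 \<le> tensor_apply T A \<bullet> A"
proof -
  have "tensor_apply T A \<bullet> transpose A = tensor_apply T A \<bullet> A"
    using inner_transpose_swap[of "tensor_apply T A" A] tensor_apply_transpose(2)[OF T, of A] by simp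
  then have "tensor_apply T A \<bullet> sym_part A = tensor_apply T A \<bullet> A"
    by (simp add: sym_part_def inner_add_right)
  then have "tensor_apply T A \<bullet> A = tensor_apply T (sym_part A) \<bullet> sym_part A"
    by (simp add: tensor_apply_sym_part[OF T])
  then show ?thesis
    using assms(2) transpose_sym_part[of A] by (simp add: strongly_elliptic_def)
qed

text \<open>The factor 1 / 2 is the inverse square of Korn's constant \<open>sqrt 2\<close>.\<close>

lemma elastic_energy_lower_bound:
  assumes T: "elasticity_tensor T" "strongly_elliptic c T" and G: "L2 A G"
    and korn: "L2_norm A G \<le> sqrt 2 * L2_norm A (\<lambda>x. sym_part (G x))"
  shows "c / 2 * (L2_norm A G)\<^sup>2 \<le> L2_inner A (\<lambda>x. tensor_apply T (G x)) G"
proof -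
  have c: "c > 0" using T(2) by (simp add: strongly_elliptic_def)
  have S: "L2 A (\<lambda>x. sym_part (G x))"
    by (rule L2_bounded_linear[OF bounded_linear_sym_part G])
  have "(L2_norm A G)\<^sup>2 \<le> (sqrt 2 * L2_norm A (\<lambda>x. sym_part (G x)))\<^sup>2"
    using korn by (intro power_mono) (auto simp: L2_norm_nonneg)
  then have "c / 2 * (L2_norm A G)\<^sup>2 \<le> c * (L2_norm A (\<lambda>x. sym_part (G x)))\<^sup>2"
    using c by (simp add: power_mult_distrib)
  also have "\<dots> = (LINT x|lebesgue_on A. c * (norm (sym_part (G x)))\<^sup>2)"
    by (simp add: L2_norm_squared)
  also have "\<dots> \<le> (LINT x|lebesgue_on A. tensor_apply T (G x) \<bullet> G x)"
    using L2_D(2)[OF S] L2_inner_integrable[OF L2_bounded_linear[OF bounded_linear_tensor_apply G] G]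
    by (intro integral_mono strongly_elliptic_sym_part T) auto
  finally show ?thesis by (simp add: L2_inner_def)
qed

section \<open>The geometric stiffness\<close>

text \<open>Completeness of Lebesgue measure, needed for the curvature, which is tied to the curve
  only almost everywhere.\<close>

lemma borel_measurable_lebesgue_on_AE:
  fixes f g :: "'a::euclidean_space \<Rightarrow> 'b::euclidean_space"
  assumes f: "f \<in> borel_measurable (lebesgue_on S)" and S: "S \<in> sets lebesgue"
    and ae: "AE x in lebesgue_on S. f x = g x"
  shows "g \<in> borel_measurable (lebesgue_on S)"
proof -
  have "(\<lambda>x. if x \<in> S then f x else 0) \<in> borel_measurable lebesgue"
    using f S by (simp add: borel_measurable_if)
  moreover have "AE x in lebesgue. x \<in> S \<longrightarrow> f x = g x"
    using ae S by (simp add: AE_restrict_space_iff)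
  then have "AE x in lebesgue. (if x \<in> S then f x else 0) = (if x \<in> S then g x else 0)"
    by eventually_elim auto
  ultimately have "(\<lambda>x. if x \<in> S then g x else 0) \<in> borel_measurable lebesgue"
    by (rule borel_measurable_AE)
  then show ?thesis using S by (simp add: borel_measurable_if)
qed

lemma has_vector_derivative_LIMSEQ:
  fixes f :: "real \<Rightarrow> 'a::real_normed_vector"
  assumes "(f has_vector_derivative D) (at x)" "filterlim h (at 0) sequentially"
  shows "(\<lambda>n. (f (x + h n) - f x) /\<^sub>R h n) \<longlonglongrightarrow> D"
proof -
  have "(\<lambda>k. norm (f (x + k) - f x - k *\<^sub>R D) / norm k) \<midarrow>0\<rightarrow> 0"
    using assms(1) by (simp add: has_vector_derivative_def has_derivative_at)
  from filterlim_compose[OF this assms(2)]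
  have "(\<lambda>n. norm (f (x + h n) - f x - h n *\<^sub>R D) / norm (h n)) \<longlonglongrightarrow> 0" .
  moreover have "eventually (\<lambda>n. h n \<noteq> 0) sequentially"
    using assms(2) by (auto simp: filterlim_at elim: eventually_mono)
  then have "eventually (\<lambda>n. norm (f (x + h n) - f x - h n *\<^sub>R D) / norm (h n) =
      norm ((f (x + h n) - f x) /\<^sub>R h n - D)) sequentially"
  proof eventually_elim
    case (elim n)
    then have "(f (x + h n) - f x) /\<^sub>R h n - D = (f (x + h n) - f x - h n *\<^sub>R D) /\<^sub>R h n"
      by (simp add: scaleR_diff_right)
    then show ?case by (simp add: divide_inverse mult.commute)
  qed
  ultimately have "(\<lambda>n. norm ((f (x + h n) - f x) /\<^sub>R h n - D)) \<longlonglongrightarrow> 0"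
    by (rule Lim_transform_eventually)
  then show ?thesis by (simp add: tendsto_norm_zero_iff LIM_zero_iff)
qed

text \<open>Since \<kappa> \<ge> 0 and |n| = 1, the Frenet equation for t makes \<kappa> almost
  everywhere the norm of t', a limit of difference quotients of a continuous function.\<close>

lemma curvature_measurable:
  assumes curve: "frenet_curve L \<gamma> t n b \<kappa> \<tau>" and L: "0 < L"
  shows "\<kappa> \<in> borel_measurable (lebesgue_on {0<..<L})"
proof -
  \<comment> \<open>Constant continuation past both ends makes the quotients continuous on the whole
    line; on the interval, T is t.\<close>
  define T where "T s = t (max 0 (min L s))" for s
  define h where "h k = inverse (real (Suc k))" for k
  define K where "K k s = norm ((T (s + h k) - T s) /\<^sub>R h k)" for k s
  have "continuous_on {0..L} t" using curve by (simp add: frenet_curve_def)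
  then have cT: "continuous_on UNIV T"
    unfolding T_def by (rule continuous_on_compose2) (use L in \<open>auto intro!: continuous_intros\<close>)
  have "continuous_on UNIV (K k)" for k
    unfolding K_def by (intro continuous_intros cT continuous_on_compose2[OF cT]) auto
  then have "K k \<in> borel_measurable borel" for k by (rule borel_measurable_continuous_onI)
  then have "(\<lambda>s. lim (\<lambda>k. K k s)) \<in> borel_measurable borel"
    by (rule borel_measurable_lim_metric)
  then have m: "(\<lambda>s. lim (\<lambda>k. K k s)) \<in> borel_measurable (lebesgue_on {0<..<L})"
    by (intro measurable_restrict_space1 measurable_completion) simp
  have ae: "AE s in lebesgue_on {0<..<L}. lim (\<lambda>k. K k s) = \<kappa> s"
  proof -
    have "AE s in lebesgue_on {0<..<L}. \<kappa> s \<ge> 0 \<and> (t has_vector_derivative \<kappa> s *\<^sub>R n s) (at s)"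
      using curve by (auto simp: frenet_curve_def elim: eventually_mono)
    then show ?thesis
    proof (rule lebesgue_on_mono)
      fix s assume der: "\<kappa> s \<ge> 0 \<and> (t has_vector_derivative \<kappa> s *\<^sub>R n s) (at s)" and s: "s \<in> {0<..<L}"
      have "(T has_vector_derivative \<kappa> s *\<^sub>R n s) (at s)"
        by (rule has_vector_derivative_transform_within_open[where S = "{0<..<L}"])
          (use der s in \<open>auto simp: T_def\<close>)
      then have "(\<lambda>k. K k s) \<longlonglongrightarrow> norm (\<kappa> s *\<^sub>R n s)"
        unfolding K_def h_def
        by (intro tendsto_norm has_vector_derivative_LIMSEQ filterlim_inverse_Suc_at_0(1))
      moreover have "norm (n s) = 1" using curve s by (simp add: frenet_curve_def)
      ultimately show "lim (\<lambda>k. K k s) = \<kappa> s" using der limI by fastforce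
    qed
  qed
  show ?thesis by (rule borel_measurable_lebesgue_on_AE[OF m _ ae]) simp
qed

lemma integral_lebesgue_on_eq_indicator_lborel:
  fixes f :: "'a::euclidean_space \<Rightarrow> real"
  assumes "f \<in> borel_measurable borel" "A \<in> sets borel"
  shows "(LINT x|lebesgue_on A. f x) = (LINT x|lborel. indicator A x * f x)"
proof -
  have "(LINT x|lebesgue_on A. f x) = (LINT x|lebesgue. indicator A x * f x)"
    using assms(2) by (simp add: integral_restrict_space)
  also have "\<dots> = (LINT x|lborel. indicator A x * f x)"
    using assms by (intro integral_completion) simp
  finally show ?thesis .
qed

text \<open>The stiffness depends on s only through \<open>\<kappa> s\<close>. As a function of that
  number it is a parameter integral of a jointly measurable integrand, hence Borel, whether or not
  the integral converges.\<close>

lemma stiffness_measurable: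
  assumes "\<kappa> \<in> borel_measurable M"
  shows "stiffness a \<kappa> \<in> borel_measurable M"
proof -
  have m: "(\<lambda>y::real^2. y $ 1) \<in> borel_measurable borel"
    by (intro borel_measurable_continuous_onI continuous_intros)
  have "(\<lambda>k. LINT y|lborel. indicator (ball 0 a) y * (1 / (1 - k * (y::real^2) $ 1))) \<in> borel_measurable borel"
  proof (rule lborel.borel_measurable_lebesgue_integral)
    have m1: "(\<lambda>x. indicat_real (ball 0 a) (snd x)) \<in> borel_measurable (borel \<Otimes>\<^sub>M (lborel :: (real^2) measure))"
      by (rule measurable_compose[OF measurable_snd borel_measurable_indicator]) simp
    have m2: "(\<lambda>x. snd x $ 1) \<in> borel_measurable (borel \<Otimes>\<^sub>M (lborel :: (real^2) measure))"
      by (rule measurable_compose[OF measurable_snd]) (simp add: m)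
    show "(\<lambda>(k, y). indicator (ball 0 a) y * (1 / (1 - k * y $ 1))) \<in> borel_measurable (borel \<Otimes>\<^sub>M (lborel :: (real^2) measure))"
      unfolding split_beta
      by (intro borel_measurable_times borel_measurable_divide borel_measurable_diff
          borel_measurable_const m1 m2 measurable_fst)
  qed
  from measurable_compose[OF assms this]
  have "(\<lambda>s. (1 / (pi * a\<^sup>2)) * (LINT y|lborel. indicator (ball 0 a) y * (1 / (1 - \<kappa> s * (y::real^2) $ 1)))) \<in> borel_measurable M"
    by simp
  moreover have "stiffness a \<kappa> s = (1 / (pi * a\<^sup>2)) * (LINT y|lborel. indicator (ball 0 a) y * (1 / (1 - \<kappa> s * (y::real^2) $ 1)))" for s
    unfolding stiffness_def disk_mean_def
    by (subst integral_lebesgue_on_eq_indicator_lborel) (use m in auto)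
  ultimately show ?thesis by (simp add: fun_eq_iff cong: measurable_cong)
qed

section \<open>Uniform upper bound for the stiffness\<close>

lemma dyadic_bracket:
  fixes x a :: real
  assumes "0 < x" "x \<le> a"
  obtains n :: nat where "a / 4 ^ Suc n < x" "x \<le> a / 4 ^ n"
proof -
  obtain m where "a / x < 4 ^ m" using real_arch_pow[of 4 "a / x"] by auto
  then have m: "a / 4 ^ m < x" using assms(1) by (simp add: divide_less_eq mult.commute)
  \<comment> \<open>The least exponent is positive because x \<le> a, and its predecessor supplies
    the upper bracket.\<close>
  define k where "k = (LEAST k. a / 4 ^ k < x)"
  have k: "a / 4 ^ k < x" unfolding k_def using m by (rule LeastI)
  have "k \<noteq> 0" by (rule notI) (use k assms(2) in simp)
  then obtain n where n: "k = Suc n" using not0_implies_Suc by blast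
  then have "\<not> a / 4 ^ n < x" using not_less_Least[of n "\<lambda>k. a / 4 ^ k < x"] by (simp add: k_def)
  then show ?thesis using that[of n] k n by auto
qed

text \<open>The weight is singular only at the point where the boundary circle touches the line
  \<open>y $ 1 = a\<close>; there the disk lies inside a parabola, and the boxes shrink parabolically.\<close>

lemma integrable_disk_weight:
  assumes a: "0 < a"
  shows "integrable (lebesgue_on (ball (0::real^2) a)) (\<lambda>y. a / (a - y $ 1))"
proof -
  have m: "(\<lambda>y::real^2. y $ 1) \<in> borel_measurable borel"
    by (intro borel_measurable_continuous_onI continuous_intros)
  have p8: "(8::real) ^ n = 4 ^ n * 2 ^ n" and p4: "(4::real) ^ n = 2 ^ n * 2 ^ n" for n
    using power_mult_distrib[of "4::real" 2 n] power_mult_distrib[of "2::real" 2 n] by simp_all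
  \<comment> \<open>In the disk y_2^2 < (a - y_1) (a + y_1), so a - y_1 \<le> 2 a / 4^n forces |y_2|
    \<le> 2 a / 2^n: quartering the width halves the height. On the n-th shell the weight is at most
    2 * 4^n and the box has area 8 a^2 / 8^n, so the products form a geometric series of ratio 1 /
    2.\<close>
  define Q :: "nat \<Rightarrow> (real^2) set" where
    "Q n = cbox (vector [a - 2 * a / 4 ^ n, - (2 * a / 2 ^ n)]) (vector [a, 2 * a / 2 ^ n])" for n
  have Q: "emeasure lborel (Q n) = ennreal (8 * a\<^sup>2 / 8 ^ n)" for n
  proof -
    have "Q n \<noteq> {}"
      unfolding Q_def interval_ne_empty_cart using a by (auto simp: forall_2)
    then have "measure lborel (Q n) = 2 * a / 4 ^ n * (4 * a / 2 ^ n)"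
      unfolding Q_def by (simp add: content_cbox_cart UNIV_2)
    also have "\<dots> = 8 * a\<^sup>2 / 8 ^ n"
      unfolding p8 by (simp add: power2_eq_square)
    finally show ?thesis
      by (subst emeasure_eq_ennreal_measure) (auto simp: Q_def emeasure_lborel_cbox_eq)
  qed
  have bound: "ennreal (indicator (ball 0 a) y * (a / (a - y $ 1))) \<le> (\<Sum>n. ennreal (2 * 4 ^ n) * indicator (Q n) y)" for y
  proof (cases "y \<in> ball 0 a")
    case True
    have sq: "(y $ 1)\<^sup>2 + (y $ 2)\<^sup>2 < a\<^sup>2"
    proof -
      have "(norm y)\<^sup>2 < a\<^sup>2" using True by (intro power_strict_mono) auto
      then show ?thesis
        unfolding power2_norm_eq_inner by (simp add: inner_vec_def sum_2 power2_eq_square)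
    qed
    have y1: "\<bar>y $ 1\<bar> < a"
      using True component_le_norm_cart[of y 1] by simp
    have "0 < a - y $ 1" "a - y $ 1 \<le> 2 * a" using y1 by auto
    then obtain n where n: "2 * a / 4 ^ Suc n < a - y $ 1" "a - y $ 1 \<le> 2 * a / 4 ^ n"
      by (rule dyadic_bracket)
    have "(y $ 2)\<^sup>2 \<le> (a - y $ 1) * (a + y $ 1)" using sq by (simp add: power2_eq_square algebra_simps)
    also have "\<dots> \<le> 2 * a / 4 ^ n * (2 * a)" using n y1 a by (intro mult_mono) auto
    also have "\<dots> = (2 * a / 2 ^ n)\<^sup>2"
      unfolding p4 by (simp add: power2_eq_square)
    finally have "\<bar>y $ 2\<bar>\<^sup>2 \<le> (2 * a / 2 ^ n)\<^sup>2" by simp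
    then have "\<bar>y $ 2\<bar> \<le> 2 * a / 2 ^ n" by (rule power2_le_imp_le) (use a in simp)
    then have "y \<in> Q n"
      using n y1 unfolding Q_def by (auto simp: mem_box_cart forall_2)
    have "a / (a - y $ 1) \<le> a / (2 * a / 4 ^ Suc n)"
      using n y1 a by (intro divide_left_mono mult_pos_pos) auto
    also have "\<dots> = 2 * 4 ^ n" using a by simp
    finally have "ennreal (indicator (ball 0 a) y * (a / (a - y $ 1))) \<le> ennreal (2 * 4 ^ n) * indicator (Q n) y"
      using True \<open>y \<in> Q n\<close> by (simp add: ennreal_leI)
    also have "\<dots> \<le> (\<Sum>n. ennreal (2 * 4 ^ n) * indicator (Q n) y)"
    proof -
      have "f n \<le> suminf f" for f :: "nat \<Rightarrow> ennreal"
        using sum_le_suminf[of f "{n}"] by simp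
      then show ?thesis .
    qed
    finally show ?thesis .
  qed simp
  have "(\<integral>\<^sup>+y. ennreal (indicator (ball 0 a) y * (a / (a - (y::real^2) $ 1))) \<partial>lborel) \<le>
      (\<integral>\<^sup>+y. (\<Sum>n. ennreal (2 * 4 ^ n) * indicator (Q n) y) \<partial>lborel)"
    by (intro nn_integral_mono bound)
  also have "\<dots> = (\<Sum>n. ennreal (2 * 4 ^ n) * emeasure lborel (Q n))"
  proof (subst nn_integral_suminf)
    have Qs: "Q n \<in> sets lborel" for n by (simp add: Q_def)
    show "(\<lambda>y. ennreal (2 * 4 ^ n) * indicator (Q n) y) \<in> borel_measurable lborel" for n
      by (intro borel_measurable_times_ennreal borel_measurable_indicator borel_measurable_const Qs)
    show "(\<Sum>n. \<integral>\<^sup>+y. ennreal (2 * 4 ^ n) * indicator (Q n) y \<partial>lborel) =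
        (\<Sum>n. ennreal (2 * 4 ^ n) * emeasure lborel (Q n))"
      by (simp only: nn_integral_cmult_indicator[OF Qs])
  qed
  also have "\<dots> = (\<Sum>n. ennreal (16 * a\<^sup>2 * (1 / 2) ^ n))"
  proof (rule suminf_cong)
    fix n
    have "(2::real) * 4 ^ n * (8 * a\<^sup>2 / 8 ^ n) = 16 * a\<^sup>2 * (1 / 2) ^ n"
      unfolding p8 by (simp add: power_one_over)
    then show "ennreal (2 * 4 ^ n) * emeasure lborel (Q n) = ennreal (16 * a\<^sup>2 * (1 / 2) ^ n)"
      by (simp add: Q ennreal_mult[symmetric])
  qed
  also have "\<dots> < \<infinity>"
  proof -
    have "summable (\<lambda>n. 16 * a\<^sup>2 * (1 / 2) ^ n)"
      by (intro summable_mult summable_geometric) simp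
    then show ?thesis by (subst suminf_ennreal2) simp_all
  qed
  finally have fin: "(\<integral>\<^sup>+y. ennreal (indicator (ball 0 a) y * (a / (a - (y::real^2) $ 1))) \<partial>lborel) < \<infinity>" .
  have nonneg: "0 \<le> indicator (ball 0 a) y * (a / (a - y $ 1))" for y :: "real^2"
    using component_le_norm_cart[of y 1] a by (auto simp: indicator_def)
  have meas: "(\<lambda>y::real^2. indicator (ball 0 a) y * (a / (a - y $ 1))) \<in> borel_measurable lborel"
    unfolding measurable_lborel2
    by (intro borel_measurable_times borel_measurable_divide borel_measurable_diff
        borel_measurable_const borel_measurable_indicator m) simp
  then have "integrable lborel (\<lambda>y::real^2. indicator (ball 0 a) y * (a / (a - y $ 1)))"
    by (rule integrableI_nonneg[OF _ AE_I2[OF nonneg] fin])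
  then have "integrable lebesgue (\<lambda>y::real^2. indicator (ball 0 a) y * (a / (a - y $ 1)))"
    using integrable_completion[OF meas] by blast
  then show ?thesis by (simp add: integrable_restrict_space)
qed

text \<open>Although a \<kappa> < 1, the curvature may come arbitrarily close to 1 / a, so the
  integrand has no uniform bound. It has a uniform integrable majorant: it is at most 1 where y_1
  \<le> 0, and at most a / (a - y_1) where y_1 > 0.\<close>

lemma stiffness_bounded:
  assumes a: "0 < a"
  obtains M where "\<And>\<kappa> s. 0 \<le> \<kappa> s \<Longrightarrow> a * \<kappa> s < 1 \<Longrightarrow> stiffness a \<kappa> s \<le> M"
proof -
  let ?B = "lebesgue_on (ball (0::real^2) a)"
  interpret finite_measure ?B by (rule finite_measure_lebesgue_on) simp
  define I where "I = (LINT y|?B. 1 + a / (a - y $ 1))"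
  show ?thesis
  proof (rule that[of "(1 / (pi * a\<^sup>2)) * I"])
    fix \<kappa> :: "real \<Rightarrow> real" and s assume k: "0 \<le> \<kappa> s" "a * \<kappa> s < 1"
    have le: "1 / (1 - \<kappa> s * y $ 1) \<le> 1 + a / (a - y $ 1)" "0 \<le> 1 / (1 - \<kappa> s * y $ 1)"
      if "y \<in> ball 0 a" for y :: "real^2"
    proof -
      have y: "\<bar>y $ 1\<bar> < a" using that component_le_norm_cart[of y 1] by simp
      have pos: "0 \<le> a / (a - y $ 1)" using y a by simp
      have "\<kappa> s * y $ 1 \<le> \<kappa> s * a" using k y by (intro mult_left_mono) auto
      then have p: "0 < 1 - \<kappa> s * y $ 1" using k by (simp add: mult.commute)
      then show "0 \<le> 1 / (1 - \<kappa> s * y $ 1)" by simp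
      show "1 / (1 - \<kappa> s * y $ 1) \<le> 1 + a / (a - y $ 1)"
      proof (cases "y $ 1 \<le> 0")
        case True
        then have "\<kappa> s * y $ 1 \<le> 0" using k by (simp add: mult_nonneg_nonpos)
        then have "1 / (1 - \<kappa> s * y $ 1) \<le> 1" using p by simp
        then show ?thesis using pos by linarith
      next
        case False
        have "a * (\<kappa> s * y $ 1) \<le> 1 * y $ 1"
          using k False mult_right_mono[of "a * \<kappa> s" 1 "y $ 1"] by (simp add: mult.assoc)
        then have "(a - y $ 1) \<le> a * (1 - \<kappa> s * y $ 1)" by (simp add: algebra_simps)
        then have "a / (a * (1 - \<kappa> s * y $ 1)) \<le> a / (a - y $ 1)"
          using p y a by (intro divide_left_mono mult_pos_pos) auto
        then have "1 / (1 - \<kappa> s * y $ 1) \<le> a / (a - y $ 1)"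
          using a by simp
        then show ?thesis by simp
      qed
    qed
    have int: "integrable ?B (\<lambda>y. 1 + a / (a - y $ 1))"
      using integrable_disk_weight[OF a] by simp
    have "(LINT y|?B. 1 / (1 - \<kappa> s * y $ 1)) \<le> I"
      unfolding I_def
      by (rule integral_mono_AE'[OF int]) (auto intro!: AE_I2 le order_trans[OF le(2) le(1)])
    then show "stiffness a \<kappa> s \<le> (1 / (pi * a\<^sup>2)) * I"
      unfolding stiffness_def disk_mean_def using a by (simp add: divide_right_mono)
  qed
qed

section \<open>Energy of the fiber\<close>

lemma H1_curve_wderiv:
  assumes "w \<in> H1_curve L"
  shows "L2 {0<..<L} w" "L2 {0<..<L} (wderiv L w)"
proof -
  have "\<exists>w'. L2 {0<..<L} w' \<and> is_weak_deriv L w w'" using assms by (simp add: H1_curve_def)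
  then have "L2 {0<..<L} (wderiv L w) \<and> is_weak_deriv L w (wderiv L w)"
    unfolding wderiv_def by (rule someI_ex)
  then show "L2 {0<..<L} (wderiv L w)" by auto
  show "L2 {0<..<L} w" using assms by (simp add: H1_curve_def)
qed

definition outer_product :: "real^'m \<Rightarrow> real^'n \<Rightarrow> real^'n^'m" where
  "outer_product p q = (\<chi> i j. p $ i * q $ j)"

lemma outer_product_inner: "outer_product p q \<bullet> outer_product r s = (p \<bullet> r) * (q \<bullet> s)"
  unfolding matrix_inner outer_product_def inner_vec_def sum_product by (simp add: mult_ac)

lemma transpose_outer_product: "transpose (outer_product p q) = outer_product q p"
  by (simp add: transpose_def outer_product_def vec_eq_iff mult.commute)

lemma norm_outer_product: "norm (outer_product p q) = norm p * norm q"
  by (simp add: norm_eq_sqrt_inner outer_product_inner real_sqrt_mult)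

lemma norm_sym_part_outer_product:
  assumes "norm q = 1"
  shows "(norm p)\<^sup>2 \<le> 2 * (norm (sym_part (outer_product p q)))\<^sup>2"
  unfolding norm_sym_part_squared using assms
  by (simp add: transpose_outer_product outer_product_inner norm_outer_product inner_commute)

lemma continuous_outer_product:
  fixes f :: "'a::topological_space \<Rightarrow> real^'m" and g :: "'a \<Rightarrow> real^'n"
  assumes "continuous_on S f" "continuous_on S g"
  shows "continuous_on S (\<lambda>x. outer_product (f x) (g x))"
  unfolding outer_product_def by (intro continuous_intros assms)

lemma L2_tgrad:
  assumes w: "w \<in> H1_curve L" and t: "continuous_on {0..L} t" "\<And>s. s \<in> {0..L} \<Longrightarrow> norm (t s) = 1"
  shows "L2 {0<..<L} (tgrad L t w)"
proof (rule L2_dominated)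
  have tg: "tgrad L t w = (\<lambda>s. outer_product (wderiv L w s) (t s))"
    by (simp add: tgrad_def outer_product_def fun_eq_iff)
  have "continuous_on {0<..<L} t" using t(1) by (rule continuous_on_subset) auto
  then have "t \<in> borel_measurable (lebesgue_on {0<..<L})"
    by (rule continuous_imp_measurable_on_sets_lebesgue) simp
  moreover have "continuous_on UNIV (\<lambda>x::(real^3) \<times> (real^3). outer_product (fst x) (snd x))"
    by (intro continuous_outer_product continuous_intros)
  ultimately show "tgrad L t w \<in> borel_measurable (lebesgue_on {0<..<L})"
    unfolding tg using L2_D(1)[OF H1_curve_wderiv(2)[OF w]] borel_measurable_continuous_Pair by blast
  show "integrable (lebesgue_on {0<..<L}) (\<lambda>s. (norm (wderiv L w s))\<^sup>2)"
    by (rule L2_D(2)[OF H1_curve_wderiv(2)[OF w]])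
  show "AE s in lebesgue_on {0<..<L}. (norm (tgrad L t w s))\<^sup>2 \<le> (norm (wderiv L w s))\<^sup>2"
    by (rule AE_I2) (simp add: tg norm_outer_product t(2))
qed

lemma fiber_energy_lower_bound:
  assumes w: "w \<in> H1_curve L" and t: "continuous_on {0..L} t" "\<And>s. s \<in> {0..L} \<Longrightarrow> norm (t s) = 1"
    and T: "elasticity_tensor T" "strongly_elliptic c T"
    and g: "g \<in> borel_measurable (lebesgue_on {0<..<L})" "0 < m"
      "AE s in lebesgue_on {0<..<L}. m \<le> g s \<and> g s \<le> M"
  shows "m * c / 2 * (L2_norm {0<..<L} (wderiv L w))\<^sup>2
    \<le> L2_inner {0<..<L} (\<lambda>s. g s *\<^sub>R tensor_apply T (tgrad L t w s)) (tgrad L t w)"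
proof -
  let ?I = "lebesgue_on {0<..<L}" and ?G = "tgrad L t w"
  have c: "c > 0" using T(2) by (simp add: strongly_elliptic_def)
  define e where "e s = tensor_apply T (?G s) \<bullet> ?G s" for s
  have e: "c / 2 * (norm (wderiv L w s))\<^sup>2 \<le> e s" if "s \<in> {0<..<L}" for s
  proof -
    have G: "?G s = outer_product (wderiv L w s) (t s)"
      by (simp add: tgrad_def outer_product_def)
    have "(norm (wderiv L w s))\<^sup>2 \<le> 2 * (norm (sym_part (?G s)))\<^sup>2"
      unfolding G using that by (intro norm_sym_part_outer_product t(2)) auto
    then have "c / 2 * (norm (wderiv L w s))\<^sup>2 \<le> c * (norm (sym_part (?G s)))\<^sup>2"
      using c by simp
    also have "\<dots> \<le> e s" unfolding e_def by (rule strongly_elliptic_sym_part[OF T])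
    finally show ?thesis .
  qed
  have e0: "0 \<le> e s" if "s \<in> {0<..<L}" for s
    using e[OF that] c by (meson mult_nonneg_nonneg order_trans zero_le_power2 divide_nonneg_pos less_imp_le zero_less_numeral)
  have L2G: "L2 {0<..<L} ?G" by (rule L2_tgrad[OF w t])
  have int_e: "integrable ?I e"
    unfolding e_def by (rule L2_inner_integrable[OF L2_bounded_linear[OF bounded_linear_tensor_apply L2G] L2G])
  \<comment> \<open>Comparing the integrals requires the larger integrand to be integrable; this is
    where \<open>M\<close> enters.\<close>
  have int_ge: "integrable ?I (\<lambda>s. g s * e s)"
  proof (rule Bochner_Integration.integrable_bound)
    show "integrable ?I (\<lambda>s. M * e s)" using int_e by simp
    show "(\<lambda>s. g s * e s) \<in> borel_measurable ?I" using g(1) int_e by (intro borel_measurable_times) auto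
    show "AE s in ?I. norm (g s * e s) \<le> norm (M * e s)"
      using g(3)
    proof (rule lebesgue_on_mono)
      fix s assume "m \<le> g s \<and> g s \<le> M" "s \<in> {0<..<L}"
      then show "norm (g s * e s) \<le> norm (M * e s)"
        using g(2) by (simp add: abs_mult mult_right_mono)
    qed
  qed
  have "m * c / 2 * (L2_norm {0<..<L} (wderiv L w))\<^sup>2 = (LINT s|?I. m * (c / 2 * (norm (wderiv L w s))\<^sup>2))"
    by (simp add: L2_norm_squared)
  also have "\<dots> \<le> (LINT s|?I. g s * e s)"
  proof (rule integral_mono_AE)
    show "integrable ?I (\<lambda>s. m * (c / 2 * (norm (wderiv L w s))\<^sup>2))"
      using L2_D(2)[OF H1_curve_wderiv(2)[OF w]] by simp
    show "AE s in ?I. m * (c / 2 * (norm (wderiv L w s))\<^sup>2) \<le> g s * e s"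
      using g(3)
    proof (rule lebesgue_on_mono)
      fix s assume s: "m \<le> g s \<and> g s \<le> M" "s \<in> {0<..<L}"
      have "m * (c / 2 * (norm (wderiv L w s))\<^sup>2) \<le> m * e s"
        using e[OF s(2)] g(2) by (intro mult_left_mono) auto
      also have "\<dots> \<le> g s * e s" using s e0[OF s(2)] by (intro mult_right_mono) auto
      finally show "m * (c / 2 * (norm (wderiv L w s))\<^sup>2) \<le> g s * e s" .
    qed
  qed (rule int_ge)
  also have "\<dots> = L2_inner {0<..<L} (\<lambda>s. g s *\<^sub>R tensor_apply T (?G s)) ?G"
    by (simp add: L2_inner_def e_def)
  finally show ?thesis .
qed

text \<open>Orthogonality of the error to w itself reads ||w||^2 = (w, r), and Cauchy-Schwarz
  finishes. Nothing about the space containing w enters, so the bound is the same for every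
  mesh.\<close>

lemma L2_norm_projection_le:
  assumes w: "L2 A w" and r: "L2 A r" and orth: "L2_inner A w (\<lambda>x. r x - w x) = 0"
  shows "L2_norm A w \<le> L2_norm A r"
proof -
  have "L2_inner A w (\<lambda>x. r x - w x) = L2_inner A w r - (L2_norm A w)\<^sup>2"
    using L2_inner_integrable[OF w r] L2_inner_integrable[OF w w]
    by (simp add: L2_inner_def L2_norm_squared inner_diff_right power2_norm_eq_inner)
  then have "L2_norm A w * L2_norm A w = L2_inner A w r"
    using orth by (simp add: power2_eq_square)
  also have "\<dots> \<le> L2_norm A w * L2_norm A r" by (rule L2_inner_le[OF w r])
  finally show ?thesis
    using L2_norm_nonneg[of A w] L2_norm_nonneg[of A r]
    by (cases "L2_norm A w = 0") (simp_all add: mult_le_cancel_left)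
qed

lemma H1_curve_norm_bounds:
  "L2_norm {0<..<L} w \<le> H1_curve_norm L w"
  "H1_curve_norm L w \<le> L2_norm {0<..<L} w + L2_norm {0<..<L} (wderiv L w)"
  unfolding H1_curve_norm_def
  by (simp_all add: real_le_rsqrt sqrt_sum_squares_le_sum L2_norm_nonneg)

section \<open>The inf-sup condition\<close>

text \<open>\<open>G\<close> and \<open>w'\<close> stand for the norms of the gradient and of the
  curve derivative, \<open>X\<close> for the pair norm, \<open>F\<close> for the energy. After (x +
  y)^2 \<le> 2 x^2 + 2 y^2, each square is bounded by the whole of \<open>F\<close>, which gives the
  two summands of the constant.\<close>

lemma discrete_coercivity:
  fixes G w' c\<^sub>1 c\<^sub>2 m X F :: real
  assumes "0 \<le> G" "0 \<le> w'" "0 < c\<^sub>1" "0 < c\<^sub>2" "0 \<le> m" "0 \<le> X" "X \<le> m * G + w'"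
    and F: "c\<^sub>1 * G\<^sup>2 + c\<^sub>2 * w'\<^sup>2 \<le> F"
  shows "X\<^sup>2 \<le> (2 * m\<^sup>2 / c\<^sub>1 + 2 / c\<^sub>2) * F"
proof -
  have F0: "c\<^sub>1 * G\<^sup>2 \<le> F" "c\<^sub>2 * w'\<^sup>2 \<le> F"
  proof -
    have "0 \<le> c\<^sub>1 * G\<^sup>2" "0 \<le> c\<^sub>2 * w'\<^sup>2" using assms(3,4) by simp_all
    then show "c\<^sub>1 * G\<^sup>2 \<le> F" "c\<^sub>2 * w'\<^sup>2 \<le> F" using F by linarith+
  qed
  have "X\<^sup>2 \<le> (m * G + w')\<^sup>2" using assms by (intro power_mono) auto
  also have "\<dots> \<le> 2 * (m * G)\<^sup>2 + 2 * w'\<^sup>2"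
    using sum_squares_bound[of "m * G" w'] by (simp add: power2_sum)
  also have "\<dots> = 2 * m\<^sup>2 / c\<^sub>1 * (c\<^sub>1 * G\<^sup>2) + 2 / c\<^sub>2 * (c\<^sub>2 * w'\<^sup>2)"
    using assms(3,4) by (simp add: power_mult_distrib)
  also have "\<dots> \<le> 2 * m\<^sup>2 / c\<^sub>1 * F + 2 / c\<^sub>2 * F"
    using assms(3,4) by (intro add_mono mult_left_mono F0) auto
  finally show ?thesis by (simp add: distrib_right)
qed

text \<open>In the extended reals the supremum exists without a bound on q, and the infimum over an
  empty K is infinite, so a trivial kernel needs no separate case.\<close>

lemma INF_SUP_ge_diagonal:
  fixes \<alpha> :: real
  assumes "\<And>u w. (u, w) \<in> K \<Longrightarrow> \<alpha> \<le> q u w u w"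
  shows "(INF (u, w)\<in>K. SUP (v, y)\<in>K. ereal (q v y u w)) \<ge> ereal \<alpha>"
proof (rule INF_greatest, clarify)
  fix u w assume uw: "(u, w) \<in> K"
  have "ereal \<alpha> \<le> ereal (q u w u w)" using assms[OF uw] by simp
  also have "\<dots> \<le> (SUP (v, y)\<in>K. ereal (q v y u w))"
    by (rule SUP_upper2[OF uw]) simp
  finally show "ereal \<alpha> \<le> (SUP (v, y)\<in>K. ereal (q v y u w))" .
qed

text \<open>Nonzero means nonzero as classes modulo null sets, which is what makes the denominators
  of the quotient positive.\<close>

lemma pair_norm_pos:
  assumes u: "u \<in> H1 A" and w: "w \<in> H1_curve L" and nz: "(u, w) \<notin> zero_pairs A L"
  shows "0 < pair_norm A L u w"
proof (rule ccontr)
  assume "\<not> 0 < pair_norm A L u w"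
  moreover have "0 \<le> L2_norm A u" "0 \<le> L2_norm A (wgrad A u)" "0 \<le> L2_norm {0<..<L} w"
    by (rule L2_norm_nonneg)+
  ultimately have "L2_norm A u = 0" "L2_norm {0<..<L} w = 0"
    using H1_curve_norm_bounds(1)[of L w] by (auto simp: pair_norm_def H1_norm_def)
  then show False
    using nz L2_norm_eq_0_imp_AE[OF H1_wgrad(1)[OF u]] L2_norm_eq_0_imp_AE[OF H1_curve_wderiv(1)[OF w]]
    by (simp add: zero_pairs_def)
qed

theorem proposition8:
  fixes \<Omega> :: "(real^3) set"
    and L a c\<^sub>\<Omega> c\<^sub>f C\<^sub>g :: real
    and \<gamma> t n b :: "real \<Rightarrow> real^3"
    and \<kappa> \<tau> :: "real \<Rightarrow> real"
    and p q :: "real^3"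
    and \<Phi> :: "real^3 \<Rightarrow> real^3"
    and C\<^sub>\<Omega> C\<^sub>f :: tensor4
    and H :: "real set"
    and \<T>\<^sub>\<Omega> :: "real \<Rightarrow> (real^3) set set"
    and \<T>\<^sub>\<Gamma> :: "real \<Rightarrow> real set set"
    and V\<^sub>h :: "real \<Rightarrow> (real^3 \<Rightarrow> real^3) set"
    and W\<^sub>h :: "real \<Rightarrow> (real \<Rightarrow> real^3) set"
  assumes "lipschitz_domain \<Omega>"
    and "fiber_geometry \<Omega> L a \<gamma> t n b \<kappa> \<tau> p q \<Phi>"
    and "averaging_bounded L a \<gamma> t n b"
    and "C\<^sub>g > 0" and "AE s in lebesgue_on {0<..<L}. stiffness a \<kappa> s \<ge> C\<^sub>g"
    and "regular_mesh_family (closure \<Omega>) H \<T>\<^sub>\<Omega>"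
    and "regular_mesh_family {0..L} H \<T>\<^sub>\<Gamma>"
    and "\<And>h. h \<in> H \<Longrightarrow> h = Max (diameter ` \<T>\<^sub>\<Omega> h \<union> diameter ` \<T>\<^sub>\<Gamma> h)"
    and "\<And>h. h \<in> H \<Longrightarrow> finite_element_space (H1_zero \<Omega>) (\<T>\<^sub>\<Omega> h) (V\<^sub>h h)"
    and "\<And>h. h \<in> H \<Longrightarrow> finite_element_space (H1_curve L) (\<T>\<^sub>\<Gamma> h) (W\<^sub>h h)"
    and "elasticity_tensor C\<^sub>\<Omega>" and "elasticity_tensor C\<^sub>f"
    and "strongly_elliptic c\<^sub>\<Omega> C\<^sub>\<Omega>" and "strongly_elliptic c\<^sub>f C\<^sub>f"
    and "c\<^sub>f > c\<^sub>\<Omega>" and "c\<^sub>\<Omega> > 0"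
    and stiffer_fiber: "\<exists>c. strongly_elliptic c (C\<^sub>f - C\<^sub>\<Omega>)"
  shows "\<exists>\<alpha>\<^sub>8>0. \<forall>h\<in>H.
    (INF (u, w) \<in> discrete_kernel L a \<gamma> n b (V\<^sub>h h) (W\<^sub>h h) - zero_pairs \<Omega> L.
      SUP (v, y) \<in> discrete_kernel L a \<gamma> n b (V\<^sub>h h) (W\<^sub>h h) - zero_pairs \<Omega> L.
        ereal (elastic_form \<Omega> L (pi * a\<^sup>2) t (stiffness a \<kappa>) C\<^sub>\<Omega> (C\<^sub>f - C\<^sub>\<Omega>) v y u w /
          (pair_norm \<Omega> L v y * pair_norm \<Omega> L u w)))
    \<ge> ereal \<alpha>\<^sub>8"
proof -
  have \<Omega>: "open \<Omega>" "bounded \<Omega>" using assms(1) by (auto simp: lipschitz_domain_def)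
  then have \<Omega>m: "\<Omega> \<in> lmeasurable" by (simp add: lmeasurable_open)
  obtain R where R: "0 < R" "\<And>x. x \<in> \<Omega> \<Longrightarrow> norm x \<le> R"
    using \<Omega>(2) by (auto simp: bounded_pos)
  let ?B = "interior (fiber L a \<gamma> t)" and ?g = "stiffness a \<kappa>"
  have geo: "0 < L" "0 < a" "frenet_curve L \<gamma> t n b \<kappa> \<tau>" "fiber L a \<gamma> t \<subseteq> \<Omega>"
    "AE s in lebesgue_on {0<..<L}. a * \<kappa> s < 1"
    using assms(2) by (auto simp: fiber_geometry_def)
  have t: "continuous_on {0..L} t" "\<And>s. s \<in> {0..L} \<Longrightarrow> norm (t s) = 1"
    using geo(3) by (auto simp: frenet_curve_def)
  \<comment> \<open>Weak gradients live on open sets, so the averaging operator is bounded on fields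
    over the interior of the fiber.\<close>
  have B: "?B \<subseteq> \<Omega>" using geo(4) interior_subset by blast
  obtain K where K: "0 \<le> K" "\<And>u. u \<in> H1 ?B \<Longrightarrow> averaging a \<gamma> n b u \<in> H1_curve L \<and>
      H1_curve_norm L (averaging a \<gamma> n b u) \<le> K * H1_norm ?B u"
  proof -
    obtain C where C: "\<And>u. u \<in> H1 ?B \<Longrightarrow> averaging a \<gamma> n b u \<in> H1_curve L \<and>
      H1_curve_norm L (averaging a \<gamma> n b u) \<le> C * H1_norm ?B u"
      using assms(3) unfolding averaging_bounded_def by blast
    \<comment> \<open>The given constant may be negative; its absolute value allows monotone
      multiplication later.\<close>
    have "C * H1_norm ?B u \<le> \<bar>C\<bar> * H1_norm ?B u" for u
      by (intro mult_right_mono) (auto simp: H1_norm_def L2_norm_nonneg)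
    then show ?thesis using C by (intro that[of "\<bar>C\<bar>"]) (auto intro: order_trans)
  qed
  obtain M where M: "\<And>\<kappa> s. 0 \<le> \<kappa> s \<Longrightarrow> a * \<kappa> s < 1 \<Longrightarrow> stiffness a \<kappa> s \<le> M"
    using stiffness_bounded[OF geo(2)] by blast
  have "AE s in lebesgue_on {0<..<L}. \<kappa> s \<ge> 0"
    using geo(3) by (auto simp: frenet_curve_def elim: eventually_mono)
  with geo(5) assms(5) have g: "AE s in lebesgue_on {0<..<L}. C\<^sub>g \<le> ?g s \<and> ?g s \<le> M"
    by eventually_elim (simp add: M)
  have gm: "?g \<in> borel_measurable (lebesgue_on {0<..<L})"
    by (intro stiffness_measurable curvature_measurable[OF geo(3,1)])
  obtain c where c: "strongly_elliptic c (C\<^sub>f - C\<^sub>\<Omega>)" using stiffer_fiber by blast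
  then have c0: "0 < c" by (simp add: strongly_elliptic_def)
  have \<delta>C: "elasticity_tensor (C\<^sub>f - C\<^sub>\<Omega>)"
    by (rule elasticity_tensor_diff) (rule assms)+
  \<comment> \<open>\<open>c\<^sub>1\<close> comes from Korn and \<open>c\<^sub>2\<close> from the
    fiber energy, weighted by pi a^2. In \<open>m\<close>, Poincare gives the factor
    \<open>2 * R + 1\<close> between the full norm of u and that of its gradient, while
    \<open>1 + K\<close> counts u itself and its contribution to w. \<open>D\<close> is then the
    constant of \<open>discrete_coercivity\<close>.\<close>
  define c\<^sub>1 c\<^sub>2 m where "c\<^sub>1 = c\<^sub>\<Omega> / 2" and "c\<^sub>2 = pi * a\<^sup>2 * (C\<^sub>g * c / 2)" and "m = (1 + K) * (2 * R + 1)"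
  have pos: "0 < c\<^sub>1" "0 < c\<^sub>2" "0 < m"
    using \<open>c\<^sub>\<Omega> > 0\<close> geo(2) \<open>C\<^sub>g > 0\<close> c0 R(1) K(1) by (auto simp: c\<^sub>1_def c\<^sub>2_def m_def)
  define D where "D = 2 * m\<^sup>2 / c\<^sub>1 + 2 / c\<^sub>2"
  have D: "0 < D" using pos by (auto simp: D_def intro!: add_pos_pos divide_pos_pos)
  show ?thesis
  proof (intro exI[of _ "1 / D"] conjI ballI)
    show "0 < 1 / D" using D by simp
    fix h assume h: "h \<in> H"
    have Vh: "V\<^sub>h h \<subseteq> H1_zero \<Omega>" and Wh: "W\<^sub>h h \<subseteq> H1_curve L"
      using assms(9)[OF h] assms(10)[OF h] by (auto simp: finite_element_space_def)
    show "ereal (1 / D) \<le> (INF (u, w) \<in> discrete_kernel L a \<gamma> n b (V\<^sub>h h) (W\<^sub>h h) - zero_pairs \<Omega> L.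
      SUP (v, y) \<in> discrete_kernel L a \<gamma> n b (V\<^sub>h h) (W\<^sub>h h) - zero_pairs \<Omega> L.
        ereal (elastic_form \<Omega> L (pi * a\<^sup>2) t (stiffness a \<kappa>) C\<^sub>\<Omega> (C\<^sub>f - C\<^sub>\<Omega>) v y u w /
          (pair_norm \<Omega> L v y * pair_norm \<Omega> L u w)))"
    proof (rule INF_SUP_ge_diagonal)
      fix u w assume uw: "(u, w) \<in> discrete_kernel L a \<gamma> n b (V\<^sub>h h) (W\<^sub>h h) - zero_pairs \<Omega> L"
      \<comment> \<open>The constraint is used for the multiplier q = w, admissible because the
        multipliers range over \<open>W\<^sub>h h\<close>.\<close>
      then have u: "u \<in> H1_zero \<Omega>" and wh: "w \<in> W\<^sub>h h" and nz: "(u, w) \<notin> zero_pairs \<Omega> L"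
        and orth: "L2_inner {0<..<L} w (\<lambda>s. averaging a \<gamma> n b u s - w s) = 0"
        using Vh by (auto simp: discrete_kernel_def)
      have w: "w \<in> H1_curve L" using wh Wh by blast
      have H1: "u \<in> H1 \<Omega>" using u by (simp add: H1_zero_def)
      let ?G = "L2_norm \<Omega> (wgrad \<Omega> u)" and ?w' = "L2_norm {0<..<L} (wderiv L w)"
      let ?F = "elastic_form \<Omega> L (pi * a\<^sup>2) t ?g C\<^sub>\<Omega> (C\<^sub>f - C\<^sub>\<Omega>) u w u w"
      let ?X = "pair_norm \<Omega> L u w"
      note kp = H1_zero_korn_poincare[OF u \<Omega>m R(2) less_imp_le[OF R(1)]]
      have "c\<^sub>1 * ?G\<^sup>2 \<le> L2_inner \<Omega> (\<lambda>x. tensor_apply C\<^sub>\<Omega> (wgrad \<Omega> u x)) (wgrad \<Omega> u)"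
        unfolding c\<^sub>1_def using assms(11,13) H1_wgrad(2)[OF H1] kp(1)
        by (rule elastic_energy_lower_bound)
      moreover have "c\<^sub>2 * ?w'\<^sup>2 \<le> pi * a\<^sup>2 *
          L2_inner {0<..<L} (\<lambda>s. ?g s *\<^sub>R tensor_apply (C\<^sub>f - C\<^sub>\<Omega>) (tgrad L t w s)) (tgrad L t w)"
        using mult_left_mono[OF fiber_energy_lower_bound[OF w t \<delta>C c gm \<open>C\<^sub>g > 0\<close> g], of "pi * a\<^sup>2"]
        by (simp add: c\<^sub>2_def mult.assoc)
      ultimately have F: "c\<^sub>1 * ?G\<^sup>2 + c\<^sub>2 * ?w'\<^sup>2 \<le> ?F"
        by (simp add: elastic_form_def)
      \<comment> \<open>Projection controls w in L^2 only, by the averages of u; the derivative of w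
        stays on the right and is paid for by the fiber energy.\<close>
      have X: "?X \<le> m * ?G + ?w'"
      proof -
        have N: "H1_norm \<Omega> u \<le> (2 * R + 1) * ?G"
          using kp(2) by (simp add: H1_norm_def algebra_simps)
        note sub = H1_subset[OF H1 B \<Omega>(1) open_interior \<Omega>(2)]
        have av: "averaging a \<gamma> n b u \<in> H1_curve L"
          "H1_curve_norm L (averaging a \<gamma> n b u) \<le> K * H1_norm ?B u"
          using K(2)[OF sub(1)] by auto
        have "L2_norm {0<..<L} w \<le> L2_norm {0<..<L} (averaging a \<gamma> n b u)"
          by (rule L2_norm_projection_le[OF H1_curve_wderiv(1)[OF w] H1_curve_wderiv(1)[OF av(1)] orth])
        also have "\<dots> \<le> K * H1_norm ?B u"
          using H1_curve_norm_bounds(1) av(2) by (rule order_trans)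
        also have "\<dots> \<le> K * H1_norm \<Omega> u" by (intro mult_left_mono sub K)
        finally have "?X \<le> H1_norm \<Omega> u + (K * H1_norm \<Omega> u + ?w')"
          using H1_curve_norm_bounds(2)[of L w] by (simp add: pair_norm_def)
        also have "\<dots> = (1 + K) * H1_norm \<Omega> u + ?w'" by (simp add: algebra_simps)
        also have "\<dots> \<le> (1 + K) * ((2 * R + 1) * ?G) + ?w'"
          using K(1) by (intro add_mono mult_left_mono N) auto
        finally show ?thesis by (simp add: m_def mult.assoc)
      qed
      have Xp: "0 < ?X" by (rule pair_norm_pos[OF H1 w nz])
      have "?X\<^sup>2 \<le> D * ?F"
        unfolding D_def
        using L2_norm_nonneg L2_norm_nonneg pos(1,2) less_imp_le[OF pos(3)] less_imp_le[OF Xp] X F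
        by (rule discrete_coercivity)
      then show "1 / D \<le> ?F / (?X * ?X)"
        using Xp D by (simp add: divide_simps power2_eq_square mult.commute)
    qed
  qed
qed

end
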